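(* Let $r\ge1$ be an integer, $\nu$ fixed with $\Re(\nu)>-\frac1{r+1}$, $a<b$, and $f,g\in C^\infty[a,b]$. Assume $\zeta\in(a,b)$ with $g(\zeta)=0$, $g^{(j)}(\zeta)=0$ for $j=1,\dots,r$, $g^{(r+1)}(\zeta)\ne0$, and $g(x)\ne0$, $g'(x)\neq0$ for $x\in[a,b]\setminus\{\zeta\}$. Let $\mathcal{H}_\nu[f]=\int_a^bf(x)J_\nu(\omega g(x))\,dx$ and $M_j(\zeta,\nu,\omega)=\int_a^b(x-\zeta)^jJ_\nu(\omega g(x))\,dx$. For a function $\phi$ let $T_r[\phi](x,y)=\sum_{j=0}^r\frac{\phi^{(j)}(y)}{j!}(x-y)^j$. Define $\widehat\sigma_0[f]=f$ and for $k\ge1$ $$\widehat\sigma_k[f](x)=g(x)^{\nu+k}\frac{d}{dx}\left[\frac{\widehat\sigma_{k-1}[f](x)-T_r[\widehat\sigma_{k-1}[f]](x,\zeta)}{g(x)^{\nu+k}g'(x)}\right]$$ (values at $\zeta$ by continuous extension). Then, as $\omega\to\infty$, $$\mathcal{H}_\nu[f]\sim\sum_{k=0}^\infty\frac{1}{(-\omega)^k}\sum_{j=0}^r\frac{\widehat\sigma_k[f]^{(j)}(\zeta)}{j!}M_j(\zeta,\nu+k,\omega)-\sum_{k=1}^\infty\frac{1}{(-\omega)^k}\left\{\frac{\widehat\sigma_{k-1}[f](b)-T_r[\widehat\sigma_{k-1}[f]](b,\zeta)}{g'(b)}J_{\nu+k}(\omega g(b))-\frac{\widehat\sigma_{k-1}[f](a)-T_r[\widehat\sigma_{k-1}[f]](a,\zeta)}{g'(a)}J_{\nu+k}(\omega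 g(a))\right\}.$$
   Context: $J_\nu$ is the Bessel function of the first kind of order $\nu$; $\sim$ denotes an asymptotic expansion as $\omega\to\infty$. *)

theory Defs
  imports "HOL-Analysis.Analysis" "HOL-Analysis.Gamma_Function" "HOL-Library.Landau_Symbols"
begin

definition vdiff :: "real \<Rightarrow> real \<Rightarrow> (real \<Rightarrow> 'b::real_normed_vector) \<Rightarrow> real \<Rightarrow> 'b" where
  "vdiff a b h x = vector_derivative h (at x within {a..b})"

definition vdiffs :: "real \<Rightarrow> real \<Rightarrow> nat \<Rightarrow> (real \<Rightarrow> 'b::real_normed_vector) \<Rightarrow> real \<Rightarrow> 'b" where
  "vdiffs a b n h = (vdiff a b ^^ n) h"

definition smooth_cl :: "real \<Rightarrow> real \<Rightarrow> (real \<Rightarrow> 'b::real_normed_vector) \<Rightarrow> bool" where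
  "smooth_cl a b h \<longleftrightarrow> (\<forall>n. \<forall>x\<in>{a..b}.
      (vdiffs a b n h has_vector_derivative vdiffs a b (Suc n) h x) (at x within {a..b}))"

definition besselJ :: "complex \<Rightarrow> complex \<Rightarrow> complex" where
  "besselJ \<nu> z = (if z = 0 then (if \<nu> = 0 then 1 else 0) else
     (z / 2) powr \<nu> * (\<Sum>m. (-1) ^ m * rGamma (of_nat m + \<nu> + 1) / fact m * (z / 2) ^ (2 * m)))"

definition taylorT :: "real \<Rightarrow> real \<Rightarrow> nat \<Rightarrow> (real \<Rightarrow> complex) \<Rightarrow> real \<Rightarrow> real \<Rightarrow> complex" where
  "taylorT a b r \<phi> x y = (\<Sum>j\<le>r. vdiffs a b j \<phi> y / fact j * of_real ((x - y) ^ j))"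

fun sigma_hat :: "real \<Rightarrow> real \<Rightarrow> nat \<Rightarrow> complex \<Rightarrow> (real \<Rightarrow> real) \<Rightarrow> real \<Rightarrow> (real \<Rightarrow> real)
                   \<Rightarrow> nat \<Rightarrow> real \<Rightarrow> complex" where
  "sigma_hat a b r \<nu> g \<zeta> f 0 = (\<lambda>x. of_real (f x))"
| "sigma_hat a b r \<nu> g \<zeta> f (Suc k) =
     (let s = sigma_hat a b r \<nu> g \<zeta> f k;
          \<mu> = \<nu> + of_nat (Suc k);
          q = (\<lambda>t. (s t - taylorT a b r s t \<zeta>) / (of_real (g t) powr \<mu> * of_real (vdiff a b g t)));
          h = (\<lambda>x. of_real (g x) powr \<mu> * vdiff a b q x)
      in (\<lambda>x. if x = \<zeta> then Lim (at \<zeta>) h else h x))"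

definition Hnu :: "real \<Rightarrow> real \<Rightarrow> complex \<Rightarrow> (real \<Rightarrow> real) \<Rightarrow> (real \<Rightarrow> real) \<Rightarrow> real \<Rightarrow> complex" where
  "Hnu a b \<nu> f g \<omega> = integral {a..b} (\<lambda>x. of_real (f x) * besselJ \<nu> (of_real (\<omega> * g x)))"

definition Mmom :: "real \<Rightarrow> real \<Rightarrow> (real \<Rightarrow> real) \<Rightarrow> nat \<Rightarrow> real \<Rightarrow> complex \<Rightarrow> real \<Rightarrow> complex" where
  "Mmom a b g j \<zeta> \<nu> \<omega> = integral {a..b} (\<lambda>x. of_real ((x - \<zeta>) ^ j) * besselJ \<nu> (of_real (\<omega> * g x)))"

definition bcoef :: "real \<Rightarrow> real \<Rightarrow> nat \<Rightarrow> complex \<Rightarrow> (real \<Rightarrow> real) \<Rightarrow> real \<Rightarrow> (real \<Rightarrow> real)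
                      \<Rightarrow> nat \<Rightarrow> real \<Rightarrow> complex" where
  "bcoef a b r \<nu> g \<zeta> f k c =
     (let s = sigma_hat a b r \<nu> g \<zeta> f (k - 1) in (s c - taylorT a b r s c \<zeta>) / of_real (vdiff a b g c))"

definition partial_exp :: "real \<Rightarrow> real \<Rightarrow> nat \<Rightarrow> complex \<Rightarrow> (real \<Rightarrow> real) \<Rightarrow> real \<Rightarrow> (real \<Rightarrow> real)
                      \<Rightarrow> nat \<Rightarrow> real \<Rightarrow> complex" where
  "partial_exp a b r \<nu> g \<zeta> f N \<omega> =
     (\<Sum>k\<le>N. 1 / (- of_real \<omega>) ^ k *
        (\<Sum>j\<le>r. vdiffs a b j (sigma_hat a b r \<nu> g \<zeta> f k) \<zeta> / fact j
                  * Mmom a b g j \<zeta> (\<nu> + of_nat k) \<omega>))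
   - (\<Sum>k\<in>{1..N}. 1 / (- of_real \<omega>) ^ k *
        (bcoef a b r \<nu> g \<zeta> f k b * besselJ (\<nu> + of_nat k) (of_real (\<omega> * g b))
         - bcoef a b r \<nu> g \<zeta> f k a * besselJ (\<nu> + of_nat k) (of_real (\<omega> * g a))))"

end

theory Submission
  imports Defs
begin

text \<open>Since \<open>d/dx [g\<^sup>\<mu> J\<^sub>\<mu>(\<omega> g)] = \<omega> g' g\<^sup>\<mu> J\<^bsub>\<mu>-1\<^esub>(\<omega> g)\<close>, and \<open>s - T\<^sub>r s\<close> vanishes to order \<open>r + 1\<close> at
  \<open>\<zeta>\<close> while \<open>g'\<close> vanishes only to order \<open>r\<close>, integrating \<open>(s - T\<^sub>r s) J\<^bsub>\<mu>-1\<^esub>(\<omega> g)\<close> by parts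
  produces no singularity: it gains a factor \<open>1/\<omega>\<close>, a boundary term, and the same kind of
  integral for the next coefficient function, which is again smooth. Iterating, the error after
  \<open>N\<close> steps is exactly \<open>(-\<omega>)\<^sup>-\<^sup>N\<close> times one such integral.

  That integral is \<open>O(\<omega>\<^sup>-\<^sup>1\<^sup>-\<^sup>1\<^sup>/\<^sup>(\<^sup>r\<^sup>+\<^sup>1\<^sup>))\<close>: after one further integration by parts, the boundary terms
  decay by \<open>J\<^sub>\<mu>(x) = O(x\<^sup>-\<^sup>1\<^sup>/\<^sup>2)\<close> (sharp enough because \<open>r \<ge> 1\<close>), and the remaining integral by
  splitting at distance \<open>\<omega>\<^sup>-\<^sup>1\<^sup>/\<^sup>(\<^sup>r\<^sup>+\<^sup>1\<^sup>)\<close> from \<open>\<zeta>\<close>. For \<open>r = 1\<close> estimating \<open>|J\<^sub>\<mu>|\<close> alone would lose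
  a logarithm, so the outer part has to be integrated by parts once more.\<close>

section \<open>Bessel functions on the real line\<close>

text \<open>The principal power is not differentiable across its cut, the negative real axis, but
  only real arguments occur here. Near \<open>x\<close> the values of \<open>f\<close> keep one
  sign; for negative ones the constant \<open>(-1) powr \<mu>\<close> factors out, and the positive
  case applies to \<open>- f\<close>.\<close>

lemma has_vector_derivative_of_real_powr:
  fixes f :: "real \<Rightarrow> real" and \<mu> :: complex
  assumes f: "(f has_real_derivative f') (at x within A)" and nz: "f x \<noteq> 0"
  shows "((\<lambda>t. of_real (f t) powr \<mu>) has_vector_derivative
           \<mu> * of_real f' / of_real (f x) * of_real (f x) powr \<mu>) (at x within A)"
proof -
  have pos: "((\<lambda>t. of_real (h t) powr \<mu>) has_vector_derivative
           \<mu> * of_real h' / of_real (h x) * of_real (h x) powr \<mu>) (at x within A)"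
    if h: "(h has_real_derivative h') (at x within A)" and h0: "h x > 0" for h :: "real \<Rightarrow> real" and h'
  proof -
    have "((\<lambda>t. complex_of_real (h t)) has_vector_derivative of_real h') (at x within A)"
      by (rule has_vector_derivative_of_real[OF h])
    moreover have "((\<lambda>z. z powr \<mu>) has_field_derivative (\<mu> * of_real (h x) powr (\<mu> - 1)))
        (at (complex_of_real (h x)) within (\<lambda>t. complex_of_real (h t)) ` A)"
      using h0 by (intro has_field_derivative_at_within[OF has_field_derivative_powr]) auto
    ultimately have "(((\<lambda>z. z powr \<mu>) \<circ> (\<lambda>t. complex_of_real (h t))) has_vector_derivative
        (of_real h' * (\<mu> * of_real (h x) powr (\<mu> - 1)))) (at x within A)"
      by (rule field_vector_diff_chain_within)
    moreover have "of_real (h x) powr (\<mu> - 1) = of_real (h x) powr \<mu> / complex_of_real (h x)"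
      using h0 by (simp add: powr_diff)
    ultimately show ?thesis by (simp add: o_def field_simps)
  qed
  show ?thesis
  proof (cases "f x > 0")
    case True
    then show ?thesis using pos f by blast
  next
    case False
    with nz have neg: "f x < 0" by simp
    have c: "continuous (at x within A) f"
      using f by (rule DERIV_continuous)
    have ev: "eventually (\<lambda>t. f t < 0) (at x within A)"
      using c neg by (auto simp: continuous_within intro: order_tendstoD(2))
    have eq: "(of_real y :: complex) powr \<mu> = (-1) powr \<mu> * of_real (-y) powr \<mu>" if "y < 0" for y :: real
      using powr_neg_real_complex[of "-y" \<mu>] that by simp
    have "((\<lambda>t. of_real (- f t) powr \<mu>) has_vector_derivative
           \<mu> * of_real (- f') / of_real (- f x) * of_real (- f x) powr \<mu>) (at x within A)"
      using neg by (intro pos) (auto intro!: derivative_eq_intros f)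
    from bounded_linear.has_vector_derivative[OF bounded_linear_mult_right this, of "(-1) powr \<mu>"]
    have "((\<lambda>t. (-1) powr \<mu> * of_real (- f t) powr \<mu>) has_vector_derivative
           \<mu> * of_real f' / of_real (f x) * of_real (f x) powr \<mu>) (at x within A)"
      unfolding eq[OF neg] by (simp add: mult_ac)
    moreover have "eventually (\<lambda>t. t \<in> A \<longrightarrow> (-1) powr \<mu> * of_real (- f t) powr \<mu> = (of_real (f t) :: complex) powr \<mu>) (nhds x)"
      using ev unfolding eventually_at_filter
      by eventually_elim (metis eq neg)
    ultimately show ?thesis
      using has_vector_derivative_cong_ev[where f = "\<lambda>t. (-1) powr \<mu> * of_real (- f t) powr \<mu>"
          and g = "\<lambda>t. of_real (f t) powr \<mu>" and x = x and S = A] eq[OF neg] by auto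
  qed
qed

text \<open>For nonzero \<open>z\<close> the modulus of \<open>z powr \<mu>\<close> is
  \<open>norm z powr Re \<mu>\<close> times \<open>exp (- Im \<mu> * Arg z)\<close>, and
  \<open>pi\<close> bounds the modulus of \<open>Arg\<close>.\<close>

lemma norm_of_real_powr_le:
  "norm ((of_real x :: complex) powr \<mu>) \<le> exp (pi * \<bar>Im \<mu>\<bar>) * \<bar>x\<bar> powr Re \<mu>"
proof -
  have "- Im \<mu> * Arg (of_real x) \<le> \<bar>Im \<mu>\<bar> * \<bar>Arg (of_real x)\<bar>"
    by (metis abs_ge_self abs_minus_cancel abs_mult)
  also have "\<dots> \<le> \<bar>Im \<mu>\<bar> * pi"
    using Arg_bounded[of "of_real x"] by (intro mult_left_mono) auto
  finally have "exp (- Im \<mu> * Arg (of_real x)) \<le> exp (pi * \<bar>Im \<mu>\<bar>)"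
    by (simp add: mult.commute)
  from mult_right_mono[OF this, of "\<bar>x\<bar> powr Re \<mu>"] show ?thesis
    unfolding norm_powr_complex norm_of_real by (simp only: powr_ge_zero mult.commute)
qed

section \<open>Power series of the entire factor of the Bessel function\<close>

definition bessel_coeff :: "complex \<Rightarrow> nat \<Rightarrow> complex" where
  "bessel_coeff \<mu> m = (-1) ^ m * rGamma (of_nat m + \<mu> + 1) / fact m"

text \<open>With \<open>w = (z / 2)\<^sup>2\<close> this is what remains of the Bessel function once
  \<open>(z / 2) powr \<mu>\<close> is split off. The branch point sits in the power alone, so
  everything about the series is ordinary analysis of an entire function.\<close>

definition bessel_entire :: "complex \<Rightarrow> complex \<Rightarrow> complex" where
  "bessel_entire \<mu> w = (\<Sum>m. bessel_coeff \<mu> m * w ^ m)"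

text \<open>This is the functional equation of \<open>rGamma\<close>. It is kept in multiplied form
  because \<open>of_nat m + \<mu> + 1\<close> may vanish.\<close>

lemma bessel_coeff_Suc:
  "(of_nat (Suc m) * (of_nat m + \<mu> + 1)) * bessel_coeff \<mu> (Suc m) = - bessel_coeff \<mu> m"
proof -
  have "bessel_coeff \<mu> (Suc m) = - ((-1) ^ m * rGamma (of_nat m + \<mu> + 1 + 1) / (of_nat (Suc m) * fact m))"
    by (simp add: bessel_coeff_def add_ac)
  then show ?thesis
    unfolding bessel_coeff_def rGamma_plus1[of "of_nat m + \<mu> + 1", symmetric]
    by (simp del: of_nat_Suc)
qed

lemma summable_bessel_coeff: "summable (\<lambda>m. bessel_coeff \<mu> m * w ^ m)"
proof -
  \<comment> \<open>For \<open>m \<ge> N\<close> both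
    \<open>norm (of_nat m + \<mu> + 1) \<ge> 1\<close> and \<open>m + 1 \<ge> 2 * norm w\<close>
    hold, so the ratio of consecutive terms is at most 1/2.\<close>
  obtain N :: nat where N: "real N > norm (\<mu> + 1) + 1 + 2 * norm w"
    using reals_Archimedean2 by blast
  show ?thesis
  proof (rule summable_ratio_test[of "1/2" N])
    fix m assume m: "m \<ge> N"
    have "norm (of_nat m :: complex) - norm (\<mu> + 1) \<le> norm (of_nat m + (\<mu> + 1))"
      by (rule norm_diff_ineq)
    then have ge: "norm (of_nat m + \<mu> + 1) \<ge> 1"
      using N m by (simp add: add.assoc) (smt (verit) norm_ge_zero of_nat_mono)
    have ge2: "2 * norm w \<le> real (Suc m)"
      using N m by (smt (verit) norm_ge_zero of_nat_mono of_nat_Suc)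
    have "norm (bessel_coeff \<mu> m) =
        real (Suc m) * norm (of_nat m + \<mu> + 1) * norm (bessel_coeff \<mu> (Suc m))"
      using arg_cong[OF bessel_coeff_Suc[of m \<mu>], of norm]
      by (simp only: norm_mult norm_minus_cancel norm_of_nat)
    also have "\<dots> \<ge> (2 * norm w) * 1 * norm (bessel_coeff \<mu> (Suc m))"
      using ge ge2 by (intro mult_mono) auto
    finally have "norm w * norm (bessel_coeff \<mu> (Suc m)) \<le> 1/2 * norm (bessel_coeff \<mu> m)" by simp
    then have "norm w * norm (bessel_coeff \<mu> (Suc m)) * norm (w ^ m) \<le> 1/2 * norm (bessel_coeff \<mu> m) * norm (w ^ m)"
      by (rule mult_right_mono) simp
    then show "norm (bessel_coeff \<mu> (Suc m) * w ^ Suc m) \<le> 1/2 * norm (bessel_coeff \<mu> m * w ^ m)"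
      by (simp add: norm_mult mult_ac)
  qed simp
qed

text \<open>The factor \<open>m + 1\<close> cancels against the factorial, and the shift left in the
  Gamma argument is a shift of the order.\<close>

lemma diffs_bessel_coeff: "diffs (bessel_coeff \<mu>) m = - bessel_coeff (\<mu> + 1) m"
proof -
  have *: "of_nat (Suc m) + \<mu> + 1 = of_nat m + (\<mu> + 1) + 1" by simp
  show ?thesis
    unfolding diffs_def bessel_coeff_def * by (simp del: of_nat_Suc)
qed

lemma DERIV_bessel_entire:
  "(bessel_entire \<mu> has_field_derivative - bessel_entire (\<mu> + 1) w) (at w)"
proof -
  have "((\<lambda>x. \<Sum>n. bessel_coeff \<mu> n * x ^ n) has_field_derivative
      (\<Sum>n. diffs (bessel_coeff \<mu>) n * w ^ n)) (at w)"
    by (intro termdiffs_strong_converges_everywhere summable_bessel_coeff)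
  then show ?thesis
    by (simp add: diffs_bessel_coeff suminf_minus[OF summable_bessel_coeff] bessel_entire_def[abs_def])
qed

text \<open>Comparing coefficients, order \<mu> has \<open>m + \<mu> + 1\<close> times the
  coefficient of order \<open>\<mu> + 1\<close>. The part \<open>\<mu> + 1\<close> gives the first
  term; the part \<open>m\<close> gives \<open>w\<close> times the derivative of the series of order
  \<open>\<mu> + 1\<close>, that is, minus the series of order \<open>\<mu> + 2\<close>.\<close>

lemma bessel_entire_rec:
  "bessel_entire \<mu> w = (\<mu> + 1) * bessel_entire (\<mu> + 1) w - w * bessel_entire (\<mu> + 2) w"
proof -
  let ?c = "bessel_coeff \<mu>" and ?d = "bessel_coeff (\<mu> + 1)"
  have coeff: "?c m = (\<mu> + 1) * ?d m + of_nat m * ?d m" for m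
  proof -
    have *: "of_nat m + (\<mu> + 1) + 1 = of_nat m + \<mu> + 1 + 1" by simp
    have "?c m = (of_nat m + \<mu> + 1) * ?d m"
      unfolding bessel_coeff_def *
      by (subst rGamma_plus1[symmetric]) (simp only: times_divide_eq_right mult.left_commute)
    then show ?thesis by (simp only: ring_distribs add_ac)
  qed
  have d: "(\<lambda>n. diffs ?d n * w ^ n) sums (- bessel_entire (\<mu> + 2) w)"
    using sums_minus[OF summable_sums[OF summable_bessel_coeff, of "\<mu> + 2" w]]
    by (simp add: diffs_bessel_coeff bessel_entire_def add.assoc)
  have "(\<lambda>n. of_nat n * ?d n * w ^ (n - Suc 0)) sums (- bessel_entire (\<mu> + 2) w)"
    using diffs_equiv[OF sums_summable[OF d]] unfolding sums_unique[OF d, symmetric] .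
  from sums_mult[OF this, of w]
  have "(\<lambda>n. w * (of_nat n * ?d n * w ^ (n - Suc 0))) sums (- w * bessel_entire (\<mu> + 2) w)"
    by simp
  moreover have "w * (of_nat n * ?d n * w ^ (n - Suc 0)) = of_nat n * ?d n * w ^ n" for n
    by (cases n) auto
  ultimately have 1: "(\<lambda>n. of_nat n * ?d n * w ^ n) sums (- w * bessel_entire (\<mu> + 2) w)"
    by (simp only:)
  have 2: "(\<lambda>n. (\<mu> + 1) * (?d n * w ^ n)) sums ((\<mu> + 1) * bessel_entire (\<mu> + 1) w)"
    unfolding bessel_entire_def by (intro sums_mult summable_sums summable_bessel_coeff)
  have "(\<lambda>n. ?c n * w ^ n) sums ((\<mu> + 1) * bessel_entire (\<mu> + 1) w + - w * bessel_entire (\<mu> + 2) w)"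
  proof -
    have "?c n * w ^ n = (\<mu> + 1) * (?d n * w ^ n) + of_nat n * ?d n * w ^ n" for n
      by (simp only: coeff ring_distribs mult.assoc)
    then show ?thesis using sums_add[OF 2 1] by simp
  qed
  then show ?thesis by (simp add: bessel_entire_def sums_iff)
qed

lemma isCont_bessel_entire [continuous_intros]:
  "isCont f x \<Longrightarrow> isCont (\<lambda>x. bessel_entire \<mu> (f x)) x"
  using DERIV_isCont[OF DERIV_bessel_entire] by (rule isCont_o2[rotated])

section \<open>Recurrence, derivatives and reflection on the real line\<close>

abbreviation besselJ_real :: "complex \<Rightarrow> real \<Rightarrow> complex" where
  "besselJ_real \<mu> x \<equiv> besselJ \<mu> (of_real x)"

lemma besselJ_real_eq:
  "x \<noteq> 0 \<Longrightarrow> besselJ_real \<mu> x = of_real (x / 2) powr \<mu> * bessel_entire \<mu> (of_real ((x / 2)\<^sup>2))"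
  by (simp add: besselJ_def bessel_entire_def bessel_coeff_def power_mult)

lemma besselJ_real_rec:
  assumes "x \<noteq> 0"
  shows "besselJ_real \<mu> x = 2 * (\<mu> + 1) / of_real x * besselJ_real (\<mu> + 1) x - besselJ_real (\<mu> + 2) x"
proof -
  define h where "h = (of_real (x / 2) :: complex)"
  have h0: "h \<noteq> 0" using assms by (simp add: h_def)
  have pow: "h powr (\<mu> + 1) = h powr \<mu> * h" "h powr (\<mu> + 2) = h powr \<mu> * h\<^sup>2"
    using h0 powr_nat'[of h 2] by (auto simp: powr_add)
  have x: "of_real x = 2 * h" by (simp add: h_def)
  have J: "besselJ_real \<mu>' x = h powr \<mu>' * bessel_entire \<mu>' (h\<^sup>2)" for \<mu>'
    by (simp add: besselJ_real_eq[OF assms] h_def)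
  show ?thesis
    unfolding J bessel_entire_rec[of \<mu>] pow unfolding x using h0
    by (simp add: field_simps)
qed

lemma besselJ_real_deriv:
  assumes "x \<noteq> 0"
  shows "(besselJ_real \<mu> has_vector_derivative
           \<mu> / of_real x * besselJ_real \<mu> x - besselJ_real (\<mu> + 1) x) (at x)"
proof -
  let ?h = "of_real (x / 2) :: complex"
  have p1: "?h powr (\<mu> + 1) = ?h powr \<mu> * ?h"
    using assms by (auto simp: powr_add)
  have d1: "((\<lambda>t. of_real (t / 2) powr \<mu>) has_vector_derivative \<mu> / of_real x * ?h powr \<mu>) (at x)"
  proof -
    have "((\<lambda>t. t / 2) has_real_derivative 1/2) (at x)"
      by (auto intro!: derivative_eq_intros)
    from has_vector_derivative_of_real_powr[OF this, of \<mu>] show ?thesis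
      using assms by simp
  qed
  have "((\<lambda>t. complex_of_real ((t / 2)\<^sup>2)) has_vector_derivative ?h) (at x)"
    by (rule has_vector_derivative_eq_rhs, rule has_vector_derivative_of_real)
       (auto intro!: derivative_eq_intros)
  from field_vector_diff_chain_within[OF this has_field_derivative_at_within[OF DERIV_bessel_entire], of \<mu>]
  have d2: "((\<lambda>t. bessel_entire \<mu> (of_real ((t / 2)\<^sup>2))) has_vector_derivative
      - ?h * bessel_entire (\<mu> + 1) (of_real ((x / 2)\<^sup>2))) (at x)"
    by (simp add: o_def)
  have "((\<lambda>t. of_real (t / 2) powr \<mu> * bessel_entire \<mu> (of_real ((t / 2)\<^sup>2))) has_vector_derivative
      \<mu> / of_real x * besselJ_real \<mu> x - besselJ_real (\<mu> + 1) x) (at x)"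
    by (rule has_vector_derivative_eq_rhs[OF has_vector_derivative_mult[OF d1 d2]])
       (simp only: besselJ_real_eq[OF assms] p1, simp add: mult_ac)
  then show ?thesis
    by (rule has_vector_derivative_transform_within[of _ _ x UNIV "\<bar>x\<bar>"])
       (use assms besselJ_real_eq in \<open>auto simp: dist_real_def\<close>)
qed

text \<open>Eliminating order \<open>\<mu> + 1\<close> by the recurrence turns the order-raising
  formula into the order-lowering one. This form lets integration by parts trade order
  \<open>\<mu> - 1\<close> for order \<mu>.\<close>

lemma besselJ_real_deriv':
  assumes "x \<noteq> 0"
  shows "(besselJ_real \<mu> has_vector_derivative
           besselJ_real (\<mu> - 1) x - \<mu> / of_real x * besselJ_real \<mu> x) (at x)"
proof (rule has_vector_derivative_eq_rhs[OF besselJ_real_deriv[OF assms]])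
  show "\<mu> / of_real x * besselJ_real \<mu> x - besselJ_real (\<mu> + 1) x =
      besselJ_real (\<mu> - 1) x - \<mu> / of_real x * besselJ_real \<mu> x"
  proof -
    have "\<mu> - 1 + 1 = \<mu>" "\<mu> - 1 + 2 = \<mu> + 1" by simp_all
    with besselJ_real_rec[OF assms, of "\<mu> - 1"]
    have "besselJ_real (\<mu> - 1) x = 2 * \<mu> / of_real x * besselJ_real \<mu> x - besselJ_real (\<mu> + 1) x"
      by (simp only:)
    then show ?thesis by simp
  qed
qed

text \<open>The entire factor is even in \<open>x\<close>, so only the principal power
  changes.\<close>

lemma besselJ_real_uminus:
  assumes "x > 0"
  shows "besselJ_real \<mu> (- x) = (-1) powr \<mu> * besselJ_real \<mu> x"
proof -
  have "- x \<noteq> 0" "x \<noteq> 0" using assms by auto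
  then show ?thesis
    using powr_neg_real_complex[of "x/2" \<mu>] assms
    unfolding besselJ_real_eq[OF \<open>- x \<noteq> 0\<close>] besselJ_real_eq[OF \<open>x \<noteq> 0\<close>] by simp
qed

section \<open>Size near zero and at infinity\<close>

lemma besselJ_real_near_0:
  "\<exists>C\<ge>0. \<forall>x. x \<noteq> 0 \<longrightarrow> \<bar>x\<bar> \<le> R \<longrightarrow> norm (besselJ_real \<mu> x) \<le> C * \<bar>x\<bar> powr Re \<mu>"
proof -
  \<comment> \<open>On a compact interval the entire factor is bounded, so the power alone governs
    the size.\<close>
  have "continuous_on {-R..R} (\<lambda>x. bessel_entire \<mu> (of_real ((x / 2)\<^sup>2)))"
    by (intro continuous_at_imp_continuous_on ballI continuous_intros) auto
  then have "bounded ((\<lambda>x. bessel_entire \<mu> (of_real ((x / 2)\<^sup>2))) ` {-R..R})"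
    by (intro compact_imp_bounded compact_continuous_image) auto
  then obtain B where B: "\<And>x. x \<in> {-R..R} \<Longrightarrow> norm (bessel_entire \<mu> (of_real ((x / 2)\<^sup>2))) \<le> B"
    unfolding bounded_iff by blast
  let ?K = "exp (pi * \<bar>Im \<mu>\<bar>) * (1/2) powr Re \<mu>"
  show ?thesis
  proof (intro exI[of _ "?K * \<bar>B\<bar>"] conjI allI impI)
    fix x :: real assume x: "x \<noteq> 0" "\<bar>x\<bar> \<le> R"
    have "\<bar>x / 2\<bar> powr Re \<mu> = \<bar>x\<bar> powr Re \<mu> * (1/2) powr Re \<mu>"
      by (simp add: powr_divide field_simps)
    then have 1: "norm ((of_real (x/2) :: complex) powr \<mu>) \<le> ?K * \<bar>x\<bar> powr Re \<mu>"
      using norm_of_real_powr_le[of "x/2" \<mu>] by (simp add: mult_ac)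
    have 2: "norm (bessel_entire \<mu> (of_real ((x / 2)\<^sup>2))) \<le> \<bar>B\<bar>"
      using x by (intro order_trans[OF B]) auto
    show "norm (besselJ_real \<mu> x) \<le> ?K * \<bar>B\<bar> * \<bar>x\<bar> powr Re \<mu>"
      using mult_mono[OF 1 2] unfolding besselJ_real_eq[OF x(1)] norm_mult by (simp add: mult_ac)
  qed simp
qed

text \<open>The function \<open>u = sqrt x * J\<^sub>\<mu> x\<close> satisfies \<open>u'' = (\<kappa> / x\<^sup>2 - 1) u\<close> with
  \<open>\<kappa> = \<mu>\<^sup>2 - 1/4\<close>, so the energy \<open>E = |u|\<^sup>2 + |u'|\<^sup>2\<close> obeys \<open>E' \<le> |\<kappa>| E / x\<^sup>2\<close>, and
  \<open>E x * exp (|\<kappa>| / x)\<close> is decreasing.\<close>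
lemma besselJ_real_decay_pos:
  "\<exists>C\<ge>0. \<forall>x\<ge>1. norm (besselJ_real \<mu> x) \<le> C / sqrt x"
proof -
  \<comment> \<open>The added 1/2 stems from differentiating \<open>sqrt x\<close>; with it,
    \<open>\<kappa>\<close> equals \<open>\<mu>\<^sup>2 - 1/4\<close>.\<close>
  define c where "c = \<mu> + 1/2"
  define \<kappa> where "\<kappa> = c\<^sup>2 - c"
  define u where "u x = of_real (sqrt x) * besselJ_real \<mu> x" for x
  define w where "w x = of_real (sqrt x) * besselJ_real (\<mu> + 1) x" for x
  \<comment> \<open>\<open>v\<close> will be the derivative of \<open>u\<close>. Since
    \<open>u' = (c / x) u - w\<close> and \<open>w' = u - (c / x) w\<close>, the second derivative
    of \<open>u\<close> comes from the two first-order formulas, without differentiating a Bessel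
    function twice.\<close>
  define v where "v x = c / of_real x * u x - w x" for x
  define E where "E x = inner (u x) (u x) + inner (v x) (v x)" for x
  have sq: "((\<lambda>x. complex_of_real (sqrt x)) has_vector_derivative (of_real (sqrt x) / (2 * of_real x))) (at x)"
    if "x > 0" for x
  proof (rule has_vector_derivative_eq_rhs, rule has_vector_derivative_of_real)
    show "(sqrt has_real_derivative (sqrt x / (2 * x))) (at x)"
      by (rule DERIV_real_sqrt[THEN DERIV_cong]) (use that in \<open>auto simp: field_simps\<close>)
  qed auto
  have du: "(u has_vector_derivative v x) (at x)" if "x > 0" for x
    unfolding u_def[abs_def]
  proof (rule has_vector_derivative_eq_rhs, rule has_vector_derivative_mult[OF sq besselJ_real_deriv])
    have "s * (\<mu> / X * J - K) + s / (2 * X) * J = c / X * (s * J) - s * K" for s X J K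
      by (simp add: c_def ring_distribs add_divide_distrib)
    then show "of_real (sqrt x) * (\<mu> / of_real x * besselJ_real \<mu> x - besselJ_real (\<mu> + 1) x)
        + of_real (sqrt x) / (2 * of_real x) * besselJ_real \<mu> x = v x"
      unfolding v_def u_def w_def .
  qed (use that in auto)
  have dw: "(w has_vector_derivative (u x - c / of_real x * w x)) (at x)" if "x > 0" for x
    unfolding w_def[abs_def]
  proof (rule has_vector_derivative_eq_rhs, rule has_vector_derivative_mult[OF sq besselJ_real_deriv'])
    have "s * (J - (\<mu> + 1) / X * K) + s / (2 * X) * K = s * J - c / X * (s * K)" for s X J K
      by (simp add: c_def ring_distribs add_divide_distrib mult_ac)
    from this[of "of_real (sqrt x)" "besselJ_real \<mu> x" "of_real x" "besselJ_real (\<mu> + 1) x"]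
    show "of_real (sqrt x) * (besselJ_real (\<mu> + 1 - 1) x - (\<mu> + 1) / of_real x * besselJ_real (\<mu> + 1) x)
        + of_real (sqrt x) / (2 * of_real x) * besselJ_real (\<mu> + 1) x
        = u x - c / of_real x * (of_real (sqrt x) * besselJ_real (\<mu> + 1) x)"
      unfolding u_def by simp
  qed (use that in auto)
  have dv: "(v has_vector_derivative (\<kappa> / of_real (x\<^sup>2) * u x - u x)) (at x)" if "x > 0" for x
  proof -
    have "((\<lambda>x. complex_of_real (1 / x)) has_vector_derivative of_real (- 1 / x\<^sup>2)) (at x)"
      by (rule has_vector_derivative_of_real)
         (use that in \<open>auto intro!: derivative_eq_intros simp: power2_eq_square\<close>)
    from has_vector_derivative_mult[OF has_vector_derivative_const[of c] this]
    have di: "((\<lambda>x. c / of_real x) has_vector_derivative (- c / of_real (x\<^sup>2))) (at x)"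
      by simp
    show ?thesis
      unfolding v_def[abs_def]
    proof (rule has_vector_derivative_eq_rhs,
          rule has_vector_derivative_diff[OF has_vector_derivative_mult[OF di du[OF that]] dw[OF that]])
      have "c / X * (c / X * U - W) + - c / X\<^sup>2 * U - (U - c / X * W) = \<kappa> / X\<^sup>2 * U - U" for X U W
        by (simp add: \<kappa>_def ring_distribs diff_divide_distrib power2_eq_square)
      then show "c / of_real x * v x + - c / of_real (x\<^sup>2) * u x - (u x - c / of_real x * w x)
          = \<kappa> / of_real (x\<^sup>2) * u x - u x"
        unfolding v_def of_real_power .
    qed
  qed
  define F where "F x = E x * exp (norm \<kappa> / x)" for x
  have dE: "(E has_real_derivative (2 * inner (v x) (\<kappa> / of_real (x\<^sup>2) * u x))) (at x)" if "x > 0" for x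
    unfolding E_def[abs_def] has_real_derivative_iff_has_vector_derivative
    by (rule has_vector_derivative_eq_rhs, rule has_vector_derivative_add,
        rule bounded_bilinear.has_vector_derivative[OF bounded_bilinear_inner du[OF that] du[OF that]],
        rule bounded_bilinear.has_vector_derivative[OF bounded_bilinear_inner dv[OF that] dv[OF that]])
       (simp add: inner_diff_right inner_diff_left inner_commute)
  have bnd: "2 * inner (v x) (\<kappa> / of_real (x\<^sup>2) * u x) \<le> norm \<kappa> / x\<^sup>2 * E x" if "x > 0" for x
  proof -
    have "inner (v x) (\<kappa> / of_real (x\<^sup>2) * u x) \<le> norm (v x) * norm (\<kappa> / of_real (x\<^sup>2) * u x)"
      by (rule norm_cauchy_schwarz)
    also have "\<dots> = norm \<kappa> / x\<^sup>2 * (norm (u x) * norm (v x))"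
      by (simp add: norm_mult norm_divide norm_power)
    finally have "2 * inner (v x) (\<kappa> / of_real (x\<^sup>2) * u x) \<le> 2 * (norm \<kappa> / x\<^sup>2 * (norm (u x) * norm (v x)))"
      by linarith
    also have "\<dots> = norm \<kappa> / x\<^sup>2 * (2 * norm (u x) * norm (v x))"
      by simp
    also have "\<dots> \<le> norm \<kappa> / x\<^sup>2 * E x"
      using sum_squares_bound[of "norm (u x)" "norm (v x)"]
      by (intro mult_left_mono) (auto simp: E_def power2_norm_eq_inner)
    finally show ?thesis .
  qed
  have F1: "F x \<le> F 1" if "x \<ge> 1" for x
  proof (rule DERIV_nonpos_imp_nonincreasing[OF that])
    fix t assume t: "1 \<le> t" "t \<le> x"
    have "(F has_real_derivative (2 * inner (v t) (\<kappa> / of_real (t\<^sup>2) * u t) - norm \<kappa> / t\<^sup>2 * E t) * exp (norm \<kappa> / t)) (at t)"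
      unfolding F_def[abs_def]
      by (rule DERIV_cong, rule DERIV_mult[OF dE], use t in simp, rule DERIV_fun_exp[OF DERIV_divide[OF DERIV_const DERIV_ident]])
         (use t in \<open>auto simp: field_simps power2_eq_square\<close>)
    moreover have "(2 * inner (v t) (\<kappa> / of_real (t\<^sup>2) * u t) - norm \<kappa> / t\<^sup>2 * E t) * exp (norm \<kappa> / t) \<le> 0"
      using bnd[of t] t by (intro mult_nonpos_nonneg) auto
    ultimately show "\<exists>y. (F has_real_derivative y) (at t) \<and> y \<le> 0" by blast
  qed
  have F0: "F 1 \<ge> 0" by (auto simp: F_def E_def)
  show ?thesis
  proof (intro exI[of _ "sqrt (F 1)"] conjI allI impI)
    fix x :: real assume x: "x \<ge> 1"
    have "(norm (u x))\<^sup>2 \<le> E x" by (auto simp: E_def power2_norm_eq_inner)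
    also have "\<dots> \<le> E x * exp (norm \<kappa> / x)"
      using mult_left_mono[of 1 "exp (norm \<kappa> / x)" "E x"] x by (simp add: E_def)
    also have "\<dots> \<le> F 1" using F1[OF x] by (simp add: F_def)
    finally have "norm (u x) \<le> sqrt (F 1)" by (rule real_le_rsqrt)
    then show "norm (besselJ_real \<mu> x) \<le> sqrt (F 1) / sqrt x"
      using x by (simp add: u_def norm_mult field_simps)
  qed (use F0 in simp)
qed

lemma besselJ_real_decay:
  "\<exists>C\<ge>0. \<forall>x. \<bar>x\<bar> \<ge> 1 \<longrightarrow> norm (besselJ_real \<mu> x) \<le> C / sqrt \<bar>x\<bar>"
proof -
  obtain C where C: "C \<ge> 0" "\<And>x. x \<ge> 1 \<Longrightarrow> norm (besselJ_real \<mu> x) \<le> C / sqrt x"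
    using besselJ_real_decay_pos[of \<mu>] by blast
  let ?K = "max 1 (norm ((-1) powr \<mu> :: complex))"
  show ?thesis
  proof (intro exI[of _ "?K * C"] conjI allI impI)
    fix x :: real assume x: "\<bar>x\<bar> \<ge> 1"
    have "norm (besselJ_real \<mu> x) \<le> ?K * norm (besselJ_real \<mu> \<bar>x\<bar>)"
    proof (cases "x > 0")
      case True
      then show ?thesis by (simp add: mult_le_cancel_right1)
    next
      case False
      then have "besselJ_real \<mu> x = (-1) powr \<mu> * besselJ_real \<mu> \<bar>x\<bar>"
        using besselJ_real_uminus[of "-x" \<mu>] x by simp
      then show ?thesis by (simp only: norm_mult) (intro mult_right_mono, auto)
    qed
    also have "\<dots> \<le> ?K * (C / sqrt \<bar>x\<bar>)"
      using C(2)[OF x] by (intro mult_left_mono) auto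
    finally show "norm (besselJ_real \<mu> x) \<le> ?K * C / sqrt \<bar>x\<bar>" by simp
  qed (use C in simp)
qed

text \<open>For \<open>Re \<mu> > 0\<close> the bound \<open>\<bar>x\<bar> powr Re \<mu>\<close> is
  at most 1 on the unit interval, and the decay estimate covers the rest.\<close>

lemma besselJ_real_bounded:
  assumes "Re \<mu> > 0"
  shows "\<exists>C\<ge>0. \<forall>x. norm (besselJ_real \<mu> x) \<le> C"
proof -
  obtain C where C: "C \<ge> 0" "\<And>x. \<bar>x\<bar> \<ge> 1 \<Longrightarrow> norm (besselJ_real \<mu> x) \<le> C / sqrt \<bar>x\<bar>"
    using besselJ_real_decay[of \<mu>] by blast
  obtain D where D: "D \<ge> 0" "\<And>x. x \<noteq> 0 \<Longrightarrow> \<bar>x\<bar> \<le> 1 \<Longrightarrow> norm (besselJ_real \<mu> x) \<le> D * \<bar>x\<bar> powr Re \<mu>"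
    using besselJ_real_near_0[of 1 \<mu>] by blast
  show ?thesis
  proof (intro exI[of _ "C + D"] conjI allI)
    fix x :: real
    consider "x = 0" | "x \<noteq> 0" "\<bar>x\<bar> \<le> 1" | "\<bar>x\<bar> \<ge> 1" by linarith
    then show "norm (besselJ_real \<mu> x) \<le> C + D"
    proof cases
      case 1
      then show ?thesis using assms C D by (auto simp: besselJ_def)
    next
      case 2
      then have "D * \<bar>x\<bar> powr Re \<mu> \<le> D * 1"
        using assms D(1) by (intro mult_left_mono powr_le1) auto
      then show ?thesis using D(2)[OF 2] C(1) by linarith
    next
      case 3
      then have "C / sqrt \<bar>x\<bar> \<le> C / 1"
        using C(1) by (intro divide_left_mono) auto
      then show ?thesis using C(2)[OF 3] D(1) by linarith
    qed
  qed (use C D in simp)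
qed

lemma isCont_besselJ_real:
  assumes "Re \<mu> > 0 \<or> x \<noteq> 0"
  shows "isCont (besselJ_real \<mu>) x"
proof (cases "x = 0")
  case False
  then show ?thesis using besselJ_real_deriv has_vector_derivative_continuous by blast
next
  case True
  with assms have re: "Re \<mu> > 0" by simp
  \<comment> \<open>\<open>Re \<mu> > 0\<close> excludes \<open>\<mu> = 0\<close>, so the value set
    by convention at zero is 0, which is also the limit.\<close>
  then have J0: "besselJ_real \<mu> 0 = 0" by (auto simp: besselJ_def)
  obtain D where D: "D \<ge> 0" "\<And>x. x \<noteq> 0 \<Longrightarrow> \<bar>x\<bar> \<le> 1 \<Longrightarrow> norm (besselJ_real \<mu> x) \<le> D * \<bar>x\<bar> powr Re \<mu>"
    using besselJ_real_near_0[of 1 \<mu>] by blast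
  have "((\<lambda>x. D * \<bar>x\<bar> powr Re \<mu>) \<longlongrightarrow> D * \<bar>0\<bar> powr Re \<mu>) (at 0)"
    using re by (intro tendsto_mult tendsto_const tendsto_powr' tendsto_rabs tendsto_ident_at) auto
  then have lim: "((\<lambda>x. D * \<bar>x\<bar> powr Re \<mu>) \<longlongrightarrow> 0) (at 0)" by simp
  have "(besselJ_real \<mu> \<longlongrightarrow> 0) (at 0)"
  proof (rule Lim_null_comparison[OF _ lim])
    show "eventually (\<lambda>x. norm (besselJ_real \<mu> x) \<le> D * \<bar>x\<bar> powr Re \<mu>) (at 0)"
      unfolding eventually_at by (rule exI[of _ 1]) (use D in auto)
  qed
  then show ?thesis using True J0 by (simp add: isCont_def)
qed

section \<open>Smooth functions on a closed interval\<close>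

text \<open>\<open>smooth_cl\<close> speaks of the specific functions \<open>vdiffs a b n h\<close>,
  for which closed formulas are awkward. Here any function serving as derivative is accepted at each
  level, so closure under sums, products and inverses is a plain induction on the order.\<close>

primrec times_diff :: "nat \<Rightarrow> real \<Rightarrow> real \<Rightarrow> (real \<Rightarrow> 'b::real_normed_vector) \<Rightarrow> bool" where
  "times_diff 0 a b h \<longleftrightarrow> True"
| "times_diff (Suc n) a b h \<longleftrightarrow> (\<exists>h'. (\<forall>x\<in>{a..b}. (h has_vector_derivative h' x) (at x within {a..b})) \<and>
     times_diff n a b h')"

lemma times_diff_SucD: "times_diff (Suc n) a b h \<Longrightarrow> times_diff n a b h"
  by (induction n arbitrary: h) force+

lemma vdiff_eqI:
  assumes "a < b" "x \<in> {a..b}" "(h has_vector_derivative h') (at x within {a..b})"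
  shows "vdiff a b h x = h'"
  unfolding vdiff_def using assms vector_derivative_within_cbox[of a b x h h'] by simp

lemma vdiff_cong:
  assumes "\<And>x. x \<in> {a..b} \<Longrightarrow> h x = k x" "x \<in> {a..b}"
  shows "vdiff a b h x = vdiff a b k x"
proof -
  have "(h has_vector_derivative y) (at x within {a..b}) \<longleftrightarrow> (k has_vector_derivative y) (at x within {a..b})" for y
    using has_vector_derivative_transform[of x "{a..b}" k h y] has_vector_derivative_transform[of x "{a..b}" h k y] assms
    by auto
  then show ?thesis by (simp add: vdiff_def vector_derivative_def)
qed

lemma vdiffs_0 [simp]: "vdiffs a b 0 h = h"
  by (simp add: vdiffs_def)

lemma vdiffs_Suc: "vdiffs a b (Suc n) h = vdiff a b (vdiffs a b n h)"
  by (simp add: vdiffs_def)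

lemma vdiffs_Suc_shift: "vdiffs a b (Suc n) h = vdiffs a b n (vdiff a b h)"
  by (simp add: vdiffs_def funpow_swap1)

lemma times_diff_cong:
  assumes "\<And>x. x \<in> {a..b} \<Longrightarrow> h x = k x" "times_diff n a b h"
  shows "times_diff n a b k"
proof (cases n)
  case (Suc m)
  then obtain h' where h': "\<forall>x\<in>{a..b}. (h has_vector_derivative h' x) (at x within {a..b})" "times_diff m a b h'"
    using assms(2) by auto
  moreover have "\<forall>x\<in>{a..b}. (k has_vector_derivative h' x) (at x within {a..b})"
    using h'(1) assms(1) by (auto intro: has_vector_derivative_transform[where f = h])
  ultimately show ?thesis using Suc by auto
qed simp

lemma smooth_cl_imp_times_diff:
  assumes "smooth_cl a b h"
  shows "times_diff n a b h"
proof -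
  have "times_diff n a b (vdiffs a b m h)" for m
  proof (induction n arbitrary: m)
    case (Suc n)
    then show ?case using assms unfolding smooth_cl_def times_diff.simps by blast
  qed simp
  from this[of 0] show ?thesis by simp
qed

text \<open>Derivatives within a nondegenerate interval are unique, so the witnesses in
  \<open>times_diff\<close> for different orders all agree with \<open>vdiff\<close> on
  \<open>{a..b}\<close>.\<close>

lemma smooth_clI:
  assumes ab: "a < b" and h: "\<And>n. times_diff n a b h"
  shows "smooth_cl a b h"
proof -
  have step: "(k has_vector_derivative vdiff a b k x) (at x within {a..b})" "times_diff n a b (vdiff a b k)"
    if k: "\<And>n. times_diff n a b k" and x: "x \<in> {a..b}" for k :: "real \<Rightarrow> 'a" and n x
  proof -
    obtain k' where k': "\<forall>x\<in>{a..b}. (k has_vector_derivative k' x) (at x within {a..b})" "times_diff n a b k'"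
      using k[of "Suc n"] by auto
    have eq: "vdiff a b k y = k' y" if "y \<in> {a..b}" for y
      by (rule vdiff_eqI[OF ab that]) (use that k' in auto)
    show "(k has_vector_derivative vdiff a b k x) (at x within {a..b})" using k' eq x by auto
    show "times_diff n a b (vdiff a b k)" by (rule times_diff_cong[OF _ k'(2)]) (simp add: eq)
  qed
  have td: "times_diff m a b (vdiffs a b n h)" for m n
  proof (induction n arbitrary: m)
    case 0
    then show ?case using h by simp
  next
    case (Suc n)
    show ?case unfolding vdiffs_Suc using step(2)[OF Suc, of a] ab by simp
  qed
  show ?thesis
    unfolding smooth_cl_def vdiffs_Suc using step(1)[OF td] by blast
qed

lemma smooth_cl_cong:
  assumes "a < b" "smooth_cl a b h" "\<And>x. x \<in> {a..b} \<Longrightarrow> h x = k x"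
  shows "smooth_cl a b k"
  using assms by (blast intro: smooth_clI times_diff_cong[of a b h k] smooth_cl_imp_times_diff)

lemma smooth_cl_deriv:
  assumes "smooth_cl a b h" "x \<in> {a..b}"
  shows "(h has_vector_derivative vdiff a b h x) (at x within {a..b})"
  using assms vdiffs_Suc[of a b 0 h] unfolding smooth_cl_def by (metis vdiffs_0)

lemma smooth_cl_vdiff: "smooth_cl a b h \<Longrightarrow> smooth_cl a b (vdiff a b h)"
  unfolding smooth_cl_def vdiffs_Suc_shift[symmetric] by blast

lemma smooth_cl_continuous_on: "smooth_cl a b h \<Longrightarrow> continuous_on {a..b} h"
  using smooth_cl_deriv has_vector_derivative_continuous
  by (metis continuous_on_eq_continuous_within)

lemma times_diff_const: "times_diff n a b (\<lambda>x. c)"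
proof (induction n arbitrary: c)
  case (Suc n)
  then show ?case by (auto intro!: exI[of _ "\<lambda>x. 0"])
qed simp

lemma times_diff_add:
  "times_diff n a b h \<Longrightarrow> times_diff n a b k \<Longrightarrow> times_diff n a b (\<lambda>x. h x + k x)"
proof (induction n arbitrary: h k)
  case (Suc n)
  then obtain h' k' where h': "\<forall>x\<in>{a..b}. (h has_vector_derivative h' x) (at x within {a..b})" "times_diff n a b h'"
    and k': "\<forall>x\<in>{a..b}. (k has_vector_derivative k' x) (at x within {a..b})" "times_diff n a b k'"
    by auto
  have "\<forall>x\<in>{a..b}. ((\<lambda>x. h x + k x) has_vector_derivative h' x + k' x) (at x within {a..b})"
    using h' k' by (auto intro!: derivative_intros)
  with Suc.IH[OF h'(2) k'(2)] show ?case
    unfolding times_diff.simps by (intro exI[of _ "\<lambda>x. h' x + k' x"] conjI)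
qed simp

lemma times_diff_mult:
  fixes h k :: "real \<Rightarrow> 'a::real_normed_algebra"
  shows "times_diff n a b h \<Longrightarrow> times_diff n a b k \<Longrightarrow> times_diff n a b (\<lambda>x. h x * k x)"
proof (induction n arbitrary: h k)
  case (Suc n)
  \<comment> \<open>The product rule leaves the undifferentiated factors in place, so these are
    needed at order \<open>n\<close> as well.\<close>
  note nd = Suc.prems[THEN times_diff_SucD]
  from Suc.prems obtain h' k' where h': "\<forall>x\<in>{a..b}. (h has_vector_derivative h' x) (at x within {a..b})" "times_diff n a b h'"
    and k': "\<forall>x\<in>{a..b}. (k has_vector_derivative k' x) (at x within {a..b})" "times_diff n a b k'"
    by auto
  have "\<forall>x\<in>{a..b}. ((\<lambda>x. h x * k x) has_vector_derivative h x * k' x + h' x * k x) (at x within {a..b})"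
    using h' k' by (auto intro!: derivative_intros)
  with times_diff_add[OF Suc.IH[OF nd(1) k'(2)] Suc.IH[OF h'(2) nd(2)]] show ?case
    unfolding times_diff.simps by (intro exI[of _ "\<lambda>x. h x * k' x + h' x * k x"] conjI)
qed simp

lemma has_vector_derivative_inverse:
  fixes h :: "real \<Rightarrow> 'a::real_normed_field"
  assumes "(h has_vector_derivative h') (at x within S)" "h x \<noteq> 0"
  shows "((\<lambda>x. inverse (h x)) has_vector_derivative - h' * (inverse (h x) * inverse (h x))) (at x within S)"
  using Deriv.has_derivative_inverse[OF assms(2) assms(1)[unfolded has_vector_derivative_def]]
  by (simp add: has_vector_derivative_def mult_ac)

lemma times_diff_inverse:
  fixes h :: "real \<Rightarrow> 'a::real_normed_field"
  assumes nz: "\<And>x. x \<in> {a..b} \<Longrightarrow> h x \<noteq> 0"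
  shows "times_diff n a b h \<Longrightarrow> times_diff n a b (\<lambda>x. inverse (h x))"
proof (induction n)
  case (Suc n)
  note IH = Suc.IH[OF times_diff_SucD[OF Suc.prems]]
  from Suc.prems obtain h' where h': "\<forall>x\<in>{a..b}. (h has_vector_derivative h' x) (at x within {a..b})" "times_diff n a b h'"
    by auto
  have "\<forall>x\<in>{a..b}. ((\<lambda>x. inverse (h x)) has_vector_derivative - h' x * (inverse (h x) * inverse (h x))) (at x within {a..b})"
    using h' nz by (intro ballI has_vector_derivative_inverse) auto
  moreover have "times_diff n a b (\<lambda>x. - h' x * (inverse (h x) * inverse (h x)))"
    using times_diff_mult[OF times_diff_mult[OF times_diff_const[of n a b "-1"] h'(2)] times_diff_mult[OF IH IH]] by simp
  ultimately show ?case
    unfolding times_diff.simps by (intro exI[of _ "\<lambda>x. - h' x * (inverse (h x) * inverse (h x))"] conjI)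
qed simp

section \<open>The algebra of smooth functions and Taylor's formula with a smooth remainder
  factor\<close>

context
  fixes a b :: real
  assumes ab: "a < b"
begin

lemma smooth_cl_const: "smooth_cl a b (\<lambda>x. c)"
  by (intro smooth_clI ab times_diff_const)

lemma smooth_cl_add: "smooth_cl a b h \<Longrightarrow> smooth_cl a b k \<Longrightarrow> smooth_cl a b (\<lambda>x. h x + k x)"
  by (rule smooth_clI[OF ab]) (intro times_diff_add smooth_cl_imp_times_diff)

lemma smooth_cl_mult:
  fixes h k :: "real \<Rightarrow> 'a::real_normed_algebra"
  shows "smooth_cl a b h \<Longrightarrow> smooth_cl a b k \<Longrightarrow> smooth_cl a b (\<lambda>x. h x * k x)"
  by (rule smooth_clI[OF ab]) (intro times_diff_mult smooth_cl_imp_times_diff)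

lemma smooth_cl_divide:
  fixes h k :: "real \<Rightarrow> 'a::real_normed_field"
  assumes "smooth_cl a b h" "smooth_cl a b k" "\<And>x. x \<in> {a..b} \<Longrightarrow> k x \<noteq> 0"
  shows "smooth_cl a b (\<lambda>x. h x / k x)"
  unfolding divide_inverse
  by (rule smooth_clI[OF ab], rule times_diff_mult)
     (use assms in \<open>auto intro: smooth_cl_imp_times_diff times_diff_inverse\<close>)

text \<open>A guessed sequence of successive derivatives is the sequence of iterated derivatives.
  This serves functions whose derivatives are known in closed form, such as parameter
  integrals.\<close>

lemma vdiffs_derivative_sequence:
  assumes D: "\<And>n x. x \<in> {a..b} \<Longrightarrow> (D n has_vector_derivative D (Suc n) x) (at x within {a..b})"
  shows "x \<in> {a..b} \<Longrightarrow> vdiffs a b n (D 0) x = D n x" and "smooth_cl a b (D 0)"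
proof -
  show eq: "vdiffs a b n (D 0) x = D n x" if "x \<in> {a..b}" for x n
    using that
  proof (induction n arbitrary: x)
    case (Suc n)
    have "vdiffs a b (Suc n) (D 0) x = vdiff a b (D n) x"
      unfolding vdiffs_Suc by (rule vdiff_cong) (use Suc in auto)
    also have "\<dots> = D (Suc n) x"
      by (rule vdiff_eqI[OF ab Suc.prems D[OF Suc.prems]])
    finally show ?case .
  qed simp
  show "smooth_cl a b (D 0)"
    unfolding smooth_cl_def
  proof (intro allI ballI)
    fix n x assume x: "x \<in> {a..b}"
    show "(vdiffs a b n (D 0) has_vector_derivative vdiffs a b (Suc n) (D 0) x) (at x within {a..b})"
      unfolding eq[OF x] by (rule has_vector_derivative_transform[OF x _ D[OF x]]) (simp add: eq)
  qed
qed

lemma smooth_cl_of_real: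
  assumes "smooth_cl a b h"
  shows "smooth_cl a b (\<lambda>x. of_real (h x) :: 'a::real_normed_algebra_1)"
    and "x \<in> {a..b} \<Longrightarrow> vdiffs a b n (\<lambda>x. of_real (h x) :: 'a) x = of_real (vdiffs a b n h x)"
proof -
  have D: "((\<lambda>x. of_real (vdiffs a b n h x) :: 'a) has_vector_derivative of_real (vdiffs a b (Suc n) h x)) (at x within {a..b})"
    if "x \<in> {a..b}" for n x
    using assms that unfolding smooth_cl_def
    by (intro has_vector_derivative_of_real) (auto simp: has_real_derivative_iff_has_vector_derivative)
  show "smooth_cl a b (\<lambda>x. of_real (h x) :: 'a)"
    using vdiffs_derivative_sequence(2)[of "\<lambda>n x. of_real (vdiffs a b n h x) :: 'a", OF D] by simp
  show "x \<in> {a..b} \<Longrightarrow> vdiffs a b n (\<lambda>x. of_real (h x) :: 'a) x = of_real (vdiffs a b n h x)"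
    using vdiffs_derivative_sequence(1)[of "\<lambda>n x. of_real (vdiffs a b n h x) :: 'a", OF D] by simp
qed

lemma smooth_cl_shift: "smooth_cl a b (\<lambda>x. of_real (x - c) :: 'a::real_normed_algebra_1)"
proof (rule smooth_cl_of_real(1)[OF smooth_clI[OF ab]])
  fix n show "times_diff n a b (\<lambda>x. x - c)"
    by (cases n) (auto intro!: exI[of _ "\<lambda>x. 1"] derivative_eq_intros times_diff_const)
qed

text \<open>Hadamard's lemma, with \<open>\<Phi> x = integral {0..1} (\<lambda>s. \<phi>' (c + s * (x - c)))\<close>.\<close>
lemma smooth_cl_hadamard:
  fixes \<phi> :: "real \<Rightarrow> 'a::banach"
  assumes \<phi>: "smooth_cl a b \<phi>" and c: "c \<in> {a..b}"
  obtains \<Phi> where "smooth_cl a b \<Phi>" "\<And>x. x \<in> {a..b} \<Longrightarrow> \<phi> x = \<phi> c + (x - c) *\<^sub>R \<Phi> x"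
    "\<And>n. vdiffs a b n \<Phi> c = vdiffs a b (Suc n) \<phi> c /\<^sub>R real (Suc n)"
proof -
  define p where "p n = vdiffs a b n \<phi>" for n
  have dp: "(p n has_vector_derivative p (Suc n) x) (at x within {a..b})" if "x \<in> {a..b}" for n x
    using \<phi> that by (simp add: smooth_cl_def p_def)
  have cp: "continuous_on {a..b} (p n)" for n
    using dp has_vector_derivative_continuous by (metis continuous_on_eq_continuous_within)
  have seg: "c + s * (x - c) \<in> {a..b}" if "x \<in> {a..b}" "s \<in> {0..1}" for x s
  proof -
    have "(1 - s) *\<^sub>R c + s *\<^sub>R x \<in> {a..b}"
      using that c by (intro convexD[OF convex_real_interval(5)]) auto
    then show ?thesis by (simp add: algebra_simps)
  qed
  \<comment> \<open>The candidate for the \<open>n\<close>-th derivative of \<open>\<Phi>\<close>: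
    each differentiation under the integral sign brings out one factor \<open>s\<close>.\<close>
  define D where "D n x = integral {0..1} (\<lambda>s. s ^ n *\<^sub>R p (Suc n) (c + s * (x - c)))" for n x
  have cont: "continuous_on ({a..b} \<times> {0..1}) (\<lambda>(x, s). s ^ m *\<^sub>R p n (c + s * (x - c)))" for m n
    unfolding case_prod_unfold
    by (intro continuous_intros continuous_on_compose2[OF cp]) (use seg in auto)
  have cont1: "continuous_on {0..1} (\<lambda>s. s ^ m *\<^sub>R p n (c + s * (x - c)))" if "x \<in> {a..b}" for m n x
    by (intro continuous_intros continuous_on_compose2[OF cp]) (use seg that in auto)
  have dD: "(D n has_vector_derivative D (Suc n) x) (at x within {a..b})" if x: "x \<in> {a..b}" for n x
  proof -
    have "((\<lambda>x. integral (cbox 0 1) (\<lambda>s. s ^ n *\<^sub>R p (Suc n) (c + s * (x - c)))) has_vector_derivative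
      integral (cbox 0 1) (\<lambda>s. s ^ Suc n *\<^sub>R p (Suc (Suc n)) (c + s * (x - c)))) (at x within {a..b})"
    proof (rule leibniz_rule_vector_derivative)
      fix y s :: real assume ys: "y \<in> {a..b}" "s \<in> cbox 0 1"
      have "((\<lambda>y. c + s * (y - c)) has_vector_derivative s) (at y within {a..b})"
        by (auto intro!: derivative_eq_intros)
      moreover have "(p (Suc n) has_vector_derivative p (Suc (Suc n)) (c + s * (y - c)))
          (at (c + s * (y - c)) within (\<lambda>y. c + s * (y - c)) ` {a..b})"
        by (rule has_vector_derivative_within_subset[OF dp]) (use seg ys in auto)
      ultimately have "(p (Suc n) \<circ> (\<lambda>y. c + s * (y - c)) has_vector_derivative s *\<^sub>R p (Suc (Suc n)) (c + s * (y - c))) (at y within {a..b})"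
        by (rule vector_diff_chain_within)
      from bounded_linear.has_vector_derivative[OF bounded_linear_scaleR_right this, of "s ^ n"]
      show "((\<lambda>y. s ^ n *\<^sub>R p (Suc n) (c + s * (y - c))) has_vector_derivative s ^ Suc n *\<^sub>R p (Suc (Suc n)) (c + s * (y - c))) (at y within {a..b})"
        by (simp add: o_def mult_ac)
    next
      fix y assume "y \<in> {a..b}"
      then show "(\<lambda>s. s ^ n *\<^sub>R p (Suc n) (c + s * (y - c))) integrable_on cbox 0 1"
        using cont1 by (simp add: integrable_continuous_interval)
    qed (use cont[of "Suc n" "Suc (Suc n)"] x in auto)
    then show ?thesis by (simp add: D_def[abs_def])
  qed
  show thesis
  proof (rule that[of "D 0"])
    show "smooth_cl a b (D 0)" by (rule vdiffs_derivative_sequence(2)[where D = D, OF dD])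
    show "\<phi> x = \<phi> c + (x - c) *\<^sub>R D 0 x" if x: "x \<in> {a..b}" for x
    proof -
      have "((\<lambda>s. (x - c) *\<^sub>R p 1 (c + s * (x - c))) has_integral \<phi> (c + 1 * (x - c)) - \<phi> (c + 0 * (x - c))) {0..1}"
      proof (rule fundamental_theorem_of_calculus)
        fix s :: real assume s: "s \<in> {0..1}"
        have "((\<lambda>s. c + s * (x - c)) has_vector_derivative (x - c)) (at s within {0..1})"
          by (auto intro!: derivative_eq_intros)
        moreover have "(p 0 has_vector_derivative p (Suc 0) (c + s * (x - c)))
            (at (c + s * (x - c)) within (\<lambda>s. c + s * (x - c)) ` {0..1})"
          by (rule has_vector_derivative_within_subset[OF dp]) (use seg x s in auto)
        ultimately show "((\<lambda>s. \<phi> (c + s * (x - c))) has_vector_derivative (x - c) *\<^sub>R p 1 (c + s * (x - c))) (at s within {0..1})"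
          by (auto dest: vector_diff_chain_within simp: o_def p_def)
      qed simp
      moreover have "((\<lambda>s. (x - c) *\<^sub>R p 1 (c + s * (x - c))) has_integral (x - c) *\<^sub>R D 0 x) {0..1}"
        using cont1[OF x, of 0 1]
        by (intro has_integral_cmul) (auto simp: D_def intro!: integrable_integral integrable_continuous_interval)
      ultimately have "\<phi> (c + 1 * (x - c)) - \<phi> (c + 0 * (x - c)) = (x - c) *\<^sub>R D 0 x"
        by (rule has_integral_unique)
      then show ?thesis by (simp add: algebra_simps)
    qed
    show "vdiffs a b n (D 0) c = vdiffs a b (Suc n) \<phi> c /\<^sub>R real (Suc n)" for n
    proof -
      \<comment> \<open>At \<open>x = c\<close> the derivative of \<phi> no longer depends on
        \<open>s\<close>, and the integral of \<open>s ^ n\<close> supplies the factor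
        \<open>1 / (n + 1)\<close>.\<close>
      have "((\<lambda>s. s ^ n *\<^sub>R p (Suc n) c) has_integral
          ((1 ^ Suc n / real (Suc n)) *\<^sub>R p (Suc n) c - (0 ^ Suc n / real (Suc n)) *\<^sub>R p (Suc n) c)) {0..1}"
      proof (rule fundamental_theorem_of_calculus)
        fix s :: real
        have "((\<lambda>s. s ^ Suc n / real (Suc n)) has_vector_derivative s ^ n) (at s within {0..1})"
          unfolding has_real_derivative_iff_has_vector_derivative[symmetric]
          by (rule DERIV_cong, rule DERIV_cdivide, rule DERIV_power[OF DERIV_ident]) (simp del: of_nat_Suc)
        from bounded_linear.has_vector_derivative[OF bounded_linear_scaleR_left this]
        show "((\<lambda>s. (s ^ Suc n / real (Suc n)) *\<^sub>R p (Suc n) c) has_vector_derivative s ^ n *\<^sub>R p (Suc n) c) (at s within {0..1})" .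
      qed simp
      then have "D n c = p (Suc n) c /\<^sub>R real (Suc n)"
        by (simp add: D_def integral_unique divide_inverse del: of_nat_Suc)
      then show ?thesis
        using vdiffs_derivative_sequence(1)[where D = D, OF dD c] by (simp add: p_def)
    qed
  qed
qed

text \<open>Hadamard's lemma is iterated. Each quotient has the derivatives of its predecessor at
  \<open>c\<close>, shifted by one and divided by the new index plus one; these divisors accumulate
  to the factorials. The gain over a mere remainder estimate is that \<open>S\<close> is smooth
  across \<open>c\<close>.\<close>

lemma smooth_cl_taylor:
  fixes \<phi> :: "real \<Rightarrow> 'a::banach"
  assumes \<phi>: "smooth_cl a b \<phi>" and c: "c \<in> {a..b}"
  obtains S where "smooth_cl a b S"
    "\<And>x. x \<in> {a..b} \<Longrightarrow> \<phi> x = (\<Sum>j<n. ((x - c) ^ j / fact j) *\<^sub>R vdiffs a b j \<phi> c) + (x - c) ^ n *\<^sub>R S x"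
    "S c = vdiffs a b n \<phi> c /\<^sub>R fact n"
proof -
  have "\<exists>S. smooth_cl a b S \<and>
    (\<forall>x\<in>{a..b}. \<phi> x = (\<Sum>j<n. ((x - c) ^ j / fact j) *\<^sub>R vdiffs a b j \<phi> c) + (x - c) ^ n *\<^sub>R S x) \<and>
    S c = vdiffs a b n \<phi> c /\<^sub>R fact n"
    using \<phi>
  proof (induction n arbitrary: \<phi>)
    case 0
    then show ?case by auto
  next
    case (Suc n)
    obtain \<Phi> where \<Phi>: "smooth_cl a b \<Phi>" "\<And>x. x \<in> {a..b} \<Longrightarrow> \<phi> x = \<phi> c + (x - c) *\<^sub>R \<Phi> x"
      "\<And>n. vdiffs a b n \<Phi> c = vdiffs a b (Suc n) \<phi> c /\<^sub>R real (Suc n)"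
      using smooth_cl_hadamard[OF Suc.prems c] by blast
    obtain S where S: "smooth_cl a b S"
      "\<And>x. x \<in> {a..b} \<Longrightarrow> \<Phi> x = (\<Sum>j<n. ((x - c) ^ j / fact j) *\<^sub>R vdiffs a b j \<Phi> c) + (x - c) ^ n *\<^sub>R S x"
      "S c = vdiffs a b n \<Phi> c /\<^sub>R fact n"
      using Suc.IH[OF \<Phi>(1)] by blast
    have "\<phi> x = (\<Sum>j<Suc n. ((x - c) ^ j / fact j) *\<^sub>R vdiffs a b j \<phi> c) + (x - c) ^ Suc n *\<^sub>R S x"
      if x: "x \<in> {a..b}" for x
    proof -
      have t: "(x - c) *\<^sub>R (((x - c) ^ j / fact j) *\<^sub>R vdiffs a b j \<Phi> c)
          = ((x - c) ^ Suc j / fact (Suc j)) *\<^sub>R vdiffs a b (Suc j) \<phi> c" for j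
        unfolding \<Phi>(3) by (simp add: divide_inverse mult_ac del: of_nat_Suc)
      have "\<phi> x = \<phi> c + (x - c) *\<^sub>R ((\<Sum>j<n. ((x - c) ^ j / fact j) *\<^sub>R vdiffs a b j \<Phi> c) + (x - c) ^ n *\<^sub>R S x)"
        by (simp only: \<Phi>(2)[OF x] S(2)[OF x, symmetric])
      also have "\<dots> = \<phi> c + (\<Sum>j<n. ((x - c) ^ Suc j / fact (Suc j)) *\<^sub>R vdiffs a b (Suc j) \<phi> c) + (x - c) ^ Suc n *\<^sub>R S x"
        by (simp only: scaleR_add_right scaleR_sum_right t) simp
      finally show ?thesis unfolding sum.lessThan_Suc_shift by simp
    qed
    moreover have "S c = vdiffs a b (Suc n) \<phi> c /\<^sub>R fact (Suc n)"
      unfolding S(3) \<Phi>(3) by (simp add: mult_ac del: of_nat_Suc)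
    ultimately show ?case using S(1) by blast
  qed
  then show thesis using that by blast
qed

end

section \<open>Integration by parts with a degenerate phase\<close>

text \<open>One step of the recursion behind \<open>sigma_hat\<close>, detached from the index: the
  order and the preceding coefficient function are free parameters.\<close>

definition sigma_step :: "real \<Rightarrow> real \<Rightarrow> nat \<Rightarrow> (real \<Rightarrow> real) \<Rightarrow> real \<Rightarrow> complex \<Rightarrow> (real \<Rightarrow> complex) \<Rightarrow> real \<Rightarrow> complex" where
  "sigma_step a b r g \<zeta> \<mu> s =
     (let q = (\<lambda>t. (s t - taylorT a b r s t \<zeta>) / (of_real (g t) powr \<mu> * of_real (vdiff a b g t)));
          h = (\<lambda>x. of_real (g x) powr \<mu> * vdiff a b q x)
      in (\<lambda>x. if x = \<zeta> then Lim (at \<zeta>) h else h x))"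

lemma sigma_hat_Suc:
  "sigma_hat a b r \<nu> g \<zeta> f (Suc k) = sigma_step a b r g \<zeta> (\<nu> + of_nat (Suc k)) (sigma_hat a b r \<nu> g \<zeta> f k)"
  by (simp only: sigma_hat.simps sigma_step_def Let_def)

text \<open>Shift and reflection carry both sides of \<open>c\<close> to the integral of
  \<open>x powr p\<close> starting at 0.\<close>

lemma integrable_on_abs_powr:
  fixes a b c p :: real
  assumes "p > -1" "a \<le> c" "c \<le> b"
  shows "(\<lambda>x. \<bar>x - c\<bar> powr p) integrable_on {a..b}"
proof (rule Henstock_Kurzweil_Integration.integrable_combine[OF assms(2,3)])
  have int: "(\<lambda>x. \<bar>x\<bar> powr p) integrable_on {0..d}" if "d \<ge> 0" for d
    using has_integral_powr_from_0[OF assms(1) that]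
    by (intro integrable_eq[OF has_integral_integrable]) auto
  have "(\<lambda>x. \<bar>x\<bar> powr p) integrable_on {0..b - c}" using int assms by simp
  from integrable_shift_real_ivl[OF this, of "- c"]
  show "(\<lambda>x. \<bar>x - c\<bar> powr p) integrable_on {c..b}" by simp
  have "(\<lambda>x. \<bar>x\<bar> powr p) integrable_on {a - c..0}"
    using Henstock_Kurzweil_Integration.integrable_reflect_real[where f = "\<lambda>x. \<bar>x\<bar> powr p" and a = 0 and b = "c - a"] int[of "c - a"] assms by simp
  from integrable_shift_real_ivl[OF this, of "- c"]
  show "(\<lambda>x. \<bar>x - c\<bar> powr p) integrable_on {a..c}" by simp
qed

text \<open>The conditions on the phase in factorised form, which displays the exact orders
  \<open>r + 1\<close> and \<open>r\<close> to which \<open>g\<close> and its derivative vanish at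
  \<zeta>. The cofactors are complex-valued so that they combine directly with the coefficient
  functions.\<close>

locale degenerate_phase =
  fixes a b \<zeta> :: real and r :: nat and g :: "real \<Rightarrow> real" and G G1 :: "real \<Rightarrow> complex"
  assumes zeta: "a < \<zeta>" "\<zeta> < b" and r: "r \<ge> 1"
    and g_deriv: "\<And>x. x \<in> {a..b} \<Longrightarrow> (g has_real_derivative vdiff a b g x) (at x within {a..b})"
    and g_eq: "\<And>x. x \<in> {a..b} \<Longrightarrow> of_real (g x) = of_real (x - \<zeta>) ^ Suc r * G x"
    and g'_eq: "\<And>x. x \<in> {a..b} \<Longrightarrow> of_real (vdiff a b g x) = of_real (x - \<zeta>) ^ r * G1 x"
    and G_smooth: "smooth_cl a b G" and G1_smooth: "smooth_cl a b G1"
    and G_nz: "\<And>x. x \<in> {a..b} \<Longrightarrow> G x \<noteq> 0" and G1_nz: "\<And>x. x \<in> {a..b} \<Longrightarrow> G1 x \<noteq> 0"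
begin

lemma ab: "a < b" using zeta by simp

lemmas smooth_intros =
  smooth_cl_add[OF ab] smooth_cl_mult[OF ab] smooth_cl_divide[OF ab] smooth_cl_const[OF ab] smooth_cl_shift[OF ab]

lemma g_nz: "x \<in> {a..b} \<Longrightarrow> x \<noteq> \<zeta> \<Longrightarrow> g x \<noteq> 0"
  using g_eq[of x] G_nz[of x] by auto

lemma g'_nz: "x \<in> {a..b} \<Longrightarrow> x \<noteq> \<zeta> \<Longrightarrow> vdiff a b g x \<noteq> 0"
  using g'_eq[of x] G1_nz[of x] by auto

text \<open>The logarithmic derivative of the phase has only a simple pole at \<zeta>, whatever
  \<open>r\<close> is.\<close>

lemma g'_over_g:
  assumes "x \<in> {a..b}" "x \<noteq> \<zeta>"
  shows "of_real (vdiff a b g x) / complex_of_real (g x) = G1 x / (of_real (x - \<zeta>) * G x)"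
  using assms by (simp add: g_eq g'_eq G_nz del: of_real_diff)

lemma g_cont: "continuous_on {a..b} g"
  using g_deriv by (meson DERIV_continuous continuous_on_eq_continuous_within)

lemma besselJ_phase_deriv:
  assumes x: "x \<in> {a..b}" "x \<noteq> \<zeta>" and \<omega>: "\<omega> > 0"
  shows "((\<lambda>x. besselJ_real \<mu> (\<omega> * g x)) has_vector_derivative
    of_real \<omega> * of_real (vdiff a b g x) * besselJ_real (\<mu> - 1) (\<omega> * g x)
    - \<mu> * (of_real (vdiff a b g x) / of_real (g x)) * besselJ_real \<mu> (\<omega> * g x)) (at x within {a..b})"
proof -
  have gx: "g x \<noteq> 0" using g_nz x by blast
  then have nz: "\<omega> * g x \<noteq> 0" using \<omega> by simp
  have "((\<lambda>x. \<omega> * g x) has_vector_derivative \<omega> * vdiff a b g x) (at x within {a..b})"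
    using DERIV_cmult[OF g_deriv[OF x(1)]] by (simp add: has_real_derivative_iff_has_vector_derivative)
  from vector_diff_chain_within[OF this has_vector_derivative_at_within[OF besselJ_real_deriv'[OF nz]]]
  have "((\<lambda>x. besselJ_real \<mu> (\<omega> * g x)) has_vector_derivative (\<omega> * vdiff a b g x) *\<^sub>R
      (besselJ_real (\<mu> - 1) (\<omega> * g x) - \<mu> / of_real (\<omega> * g x) * besselJ_real \<mu> (\<omega> * g x)))
      (at x within {a..b})"
    by (simp only: o_def)
  then show ?thesis
    by (rule has_vector_derivative_eq_rhs) (use \<omega> gx in \<open>simp add: scaleR_conv_of_real field_simps\<close>)
qed

lemma besselJ_phase_continuous_on:
  assumes "S \<subseteq> {a..b}" "\<omega> > 0" "Re \<mu> > 0 \<or> \<zeta> \<notin> S"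
  shows "continuous_on S (\<lambda>x. besselJ_real \<mu> (\<omega> * g x))"
proof -
  have c: "continuous_on S (\<lambda>x. \<omega> * g x)"
    using continuous_on_subset[OF g_cont assms(1)] by (intro continuous_intros)
  have "isCont (besselJ_real \<mu>) (\<omega> * g x)" if "x \<in> S" for x
  proof (rule isCont_besselJ_real)
    show "0 < Re \<mu> \<or> \<omega> * g x \<noteq> 0"
      using assms that g_nz[of x] by (cases "x = \<zeta>") auto
  qed
  then have "continuous_on ((\<lambda>x. \<omega> * g x) ` S) (besselJ_real \<mu>)"
    by (intro continuous_at_imp_continuous_on) auto
  from continuous_on_compose[OF c this] show ?thesis by (simp add: o_def)
qed

text \<open>Near \<zeta> the Bessel factor is at most of size
  \<open>\<bar>x - \<zeta>\<bar> powr ((r + 1) * Re \<mu>)\<close>, and the condition on \<mu> says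
  that this exponent exceeds -1.\<close>

lemma integrable_mult_besselJ_phase:
  assumes \<phi>: "continuous_on {a..b} \<phi>" and \<omega>: "\<omega> > 0" and \<mu>: "Re \<mu> > - 1 / (real r + 1)"
  shows "(\<lambda>x. \<phi> x * besselJ_real \<mu> (\<omega> * g x)) integrable_on {a..b}"
proof -
  let ?p = "Re \<mu>" and ?q = "(real r + 1) * Re \<mu>"
  have q: "?q > -1" using \<mu> by (simp add: field_simps)
  have bdd: "\<exists>B. \<forall>x\<in>{a..b}. norm (h x) \<le> B" if "continuous_on {a..b} h" for h :: "real \<Rightarrow> 'a::real_normed_vector"
    using compact_imp_bounded[OF compact_continuous_image[OF that compact_Icc]] by (auto simp: bounded_iff)
  obtain B1 where B1: "\<And>x. x \<in> {a..b} \<Longrightarrow> norm (\<phi> x) \<le> B1" using bdd[OF \<phi>] by blast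
  \<comment> \<open>\<open>?p\<close> may be negative; the power stays bounded because
    \<open>G\<close> has no zero.\<close>
  have "continuous_on {a..b} (\<lambda>x. norm (G x) powr ?p)"
    using G_nz by (intro continuous_intros smooth_cl_continuous_on G_smooth) auto
  then obtain B2 where B2: "\<And>x. x \<in> {a..b} \<Longrightarrow> norm (norm (G x) powr ?p) \<le> B2" using bdd by blast
  \<comment> \<open>All arguments \<open>\<omega> * g x\<close> lie within
    \<open>\<omega> * R\<close> of zero, so the small-argument bound serves on the whole interval
    for this fixed \<omega>.\<close>
  obtain R where R: "\<And>x. x \<in> {a..b} \<Longrightarrow> norm (g x) \<le> R" using bdd[OF g_cont] by blast
  obtain C where C: "C \<ge> 0" "\<And>x. x \<noteq> 0 \<Longrightarrow> \<bar>x\<bar> \<le> \<omega> * R \<Longrightarrow> norm (besselJ_real \<mu> x) \<le> C * \<bar>x\<bar> powr ?p"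
    using besselJ_real_near_0[of "\<omega> * R" \<mu>] by blast
  let ?S = "{a..b} - {\<zeta>}"
  let ?K = "B1 * (C * (\<omega> powr ?p * B2))"
  have "(\<lambda>x. \<phi> x * besselJ_real \<mu> (\<omega> * g x)) integrable_on ?S"
  proof (rule measurable_bounded_by_integrable_imp_integrable)
    show S: "?S \<in> sets lebesgue" by auto
    show "(\<lambda>x. \<phi> x * besselJ_real \<mu> (\<omega> * g x)) \<in> borel_measurable (lebesgue_on ?S)"
      using \<omega> by (intro continuous_imp_measurable_on_sets_lebesgue S continuous_on_mult
          continuous_on_subset[OF \<phi>] besselJ_phase_continuous_on) auto
    have "(\<lambda>x. \<bar>x - \<zeta>\<bar> powr ?q) integrable_on {a..b}"
      using integrable_on_abs_powr[OF q] zeta by auto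
    then have "(\<lambda>x. \<bar>x - \<zeta>\<bar> powr ?q) integrable_on ?S"
      by (rule integrable_spike_set) (auto intro: negligible_subset[of "{\<zeta>}"])
    then show "(\<lambda>x. ?K * \<bar>x - \<zeta>\<bar> powr ?q) integrable_on ?S"
      by (rule integrable_on_mult_right)
    fix x assume x: "x \<in> ?S"
    have gx: "g x \<noteq> 0" using g_nz x by auto
    have "\<bar>g x\<bar> = \<bar>x - \<zeta>\<bar> ^ Suc r * norm (G x)"
      using arg_cong[OF g_eq[of x], of norm] x by (simp only: norm_of_real norm_mult norm_power) simp
    also have "\<bar>x - \<zeta>\<bar> ^ Suc r = \<bar>x - \<zeta>\<bar> powr real (Suc r)"
      using x by (intro powr_realpow[symmetric]) auto
    finally have "\<bar>g x\<bar> powr ?p = (\<bar>x - \<zeta>\<bar> powr real (Suc r)) powr ?p * norm (G x) powr ?p"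
      by (simp only: powr_mult)
    also have "\<dots> \<le> \<bar>x - \<zeta>\<bar> powr ?q * B2"
      using B2[of x] x by (intro mult_mono) (auto simp: powr_powr add.commute)
    finally have 1: "\<bar>g x\<bar> powr ?p \<le> \<bar>x - \<zeta>\<bar> powr ?q * B2" .
    have "\<bar>\<omega> * g x\<bar> \<le> \<omega> * R" using R[of x] x \<omega> by (simp add: abs_mult)
    then have "norm (besselJ_real \<mu> (\<omega> * g x)) \<le> C * \<bar>\<omega> * g x\<bar> powr ?p"
      using gx \<omega> by (intro C(2)) auto
    also have "\<dots> = C * (\<omega> powr ?p * \<bar>g x\<bar> powr ?p)"
      using \<omega> by (simp add: abs_mult powr_mult)
    also have "\<dots> \<le> C * (\<omega> powr ?p * (\<bar>x - \<zeta>\<bar> powr ?q * B2))"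
      by (intro mult_left_mono 1 C(1)) auto
    finally have 2: "norm (besselJ_real \<mu> (\<omega> * g x)) \<le> C * (\<omega> powr ?p * (\<bar>x - \<zeta>\<bar> powr ?q * B2))" .
    have 3: "norm (\<phi> x) \<le> B1" using B1 x by auto
    then have "B1 \<ge> 0" using norm_ge_zero order_trans by blast
    from mult_mono[OF 3 2 this norm_ge_zero]
    show "norm (\<phi> x * besselJ_real \<mu> (\<omega> * g x)) \<le> ?K * \<bar>x - \<zeta>\<bar> powr ?q"
      by (simp add: norm_mult mult_ac)
  qed
  then show ?thesis
    by (rule integrable_spike_set) (auto intro: negligible_subset[of "{\<zeta>}"])
qed

section \<open>The coefficient recursion and one integration by parts\<close>

lemma taylorT_eq:
  "taylorT a b r s x \<zeta> = (\<Sum>j<Suc r. ((x - \<zeta>) ^ j / fact j) *\<^sub>R vdiffs a b j s \<zeta>)"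
  by (simp add: taylorT_def lessThan_Suc_atMost scaleR_conv_of_real field_simps)

text \<open>With \<open>P = (s - T\<^sub>r s) / g'\<close>, which extends smoothly to \<open>\<zeta>\<close>, the factors \<open>g\<^sup>\<mu>\<close> in the
  definition of the next coefficient function cancel and leave \<open>P' - \<mu> (g'/g) P\<close>.\<close>
lemma sigma_step_smooth:
  assumes s: "smooth_cl a b s"
  obtains P where "smooth_cl a b P"
    "\<And>x. x \<in> {a..b} \<Longrightarrow> s x - taylorT a b r s x \<zeta> = of_real (vdiff a b g x) * P x"
    "smooth_cl a b (sigma_step a b r g \<zeta> \<mu> s)"
    "P \<zeta> = 0"
    "\<And>x. x \<in> {a..b} \<Longrightarrow> x \<noteq> \<zeta> \<Longrightarrow>
      sigma_step a b r g \<zeta> \<mu> s x = vdiff a b P x - \<mu> * (of_real (vdiff a b g x) / of_real (g x)) * P x"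
proof -
  have \<zeta>: "\<zeta> \<in> {a..b}" using zeta by simp
  obtain S where S: "smooth_cl a b S"
    "\<And>x. x \<in> {a..b} \<Longrightarrow> s x = (\<Sum>j<Suc r. ((x - \<zeta>) ^ j / fact j) *\<^sub>R vdiffs a b j s \<zeta>) + (x - \<zeta>) ^ Suc r *\<^sub>R S x"
    using smooth_cl_taylor[OF ab s \<zeta>, where n = "Suc r"] by blast
  \<comment> \<open>The remainder is \<open>(x - \<zeta>) ^ (r + 1)\<close> times \<open>S\<close>,
    the derivative of the phase \<open>(x - \<zeta>) ^ r\<close> times \<open>G1\<close>. Their
    quotient is \<open>P\<close>, with one factor \<open>x - \<zeta>\<close> to spare.\<close>
  define Q where "Q x = S x / G1 x" for x
  define P where "P x = of_real (x - \<zeta>) * Q x" for x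
  \<comment> \<open>The spare factor of \<open>P\<close> cancels the simple pole of the logarithmic
    derivative of \<open>g\<close>, so this formula makes sense at \<zeta> too.\<close>
  define \<sigma> where "\<sigma> x = vdiff a b P x + - \<mu> * (Q x * G1 x / G x)" for x
  have Q: "smooth_cl a b Q" unfolding Q_def by (intro smooth_intros S(1) G1_smooth G1_nz)
  have P: "smooth_cl a b P" unfolding P_def by (intro smooth_intros Q)
  have \<sigma>: "smooth_cl a b \<sigma>" unfolding \<sigma>_def
    by (intro smooth_intros smooth_cl_vdiff P Q G_smooth G1_smooth G_nz)
  have rem: "s x - taylorT a b r s x \<zeta> = of_real (vdiff a b g x) * P x" if x: "x \<in> {a..b}" for x
  proof -
    have "s x - taylorT a b r s x \<zeta> = of_real (x - \<zeta>) ^ Suc r * S x"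
      unfolding taylorT_eq using S(2)[OF x] by (simp add: scaleR_conv_of_real)
    then show ?thesis
      unfolding g'_eq[OF x] P_def Q_def using G1_nz[OF x] by simp
  qed
  define q where "q t = (s t - taylorT a b r s t \<zeta>) / (of_real (g t) powr \<mu> * of_real (vdiff a b g t))" for t
  define h where "h x = of_real (g x) powr \<mu> * vdiff a b q x" for x
  have sig: "sigma_step a b r g \<zeta> \<mu> s x = (if x = \<zeta> then Lim (at \<zeta>) h else h x)" for x
    unfolding sigma_step_def Let_def h_def[abs_def] q_def[abs_def] by simp
  have h': "h x = vdiff a b P x - \<mu> * (of_real (vdiff a b g x) / of_real (g x)) * P x"
    if x: "x \<in> {a..b}" "x \<noteq> \<zeta>" for x
  proof -
    define W where "W = (complex_of_real (g x) powr \<mu>)"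
    have W: "W \<noteq> 0" using g_nz[OF x] by (simp add: W_def)
    have dW: "((\<lambda>t. of_real (g t) powr \<mu>) has_vector_derivative
        \<mu> * of_real (vdiff a b g x) / of_real (g x) * W) (at x within {a..b})"
      unfolding W_def using g_nz[OF x] by (intro has_vector_derivative_of_real_powr g_deriv x)
    have dP: "(P has_vector_derivative vdiff a b P x) (at x within {a..b})"
      by (rule smooth_cl_deriv[OF P x(1)])
    have dq: "((\<lambda>t. P t * inverse (of_real (g t) powr \<mu>)) has_vector_derivative
        P x * (- (\<mu> * of_real (vdiff a b g x) / of_real (g x) * W) * (inverse W * inverse W))
        + vdiff a b P x * inverse W) (at x within {a..b})"
      using has_vector_derivative_mult[OF dP has_vector_derivative_inverse[OF dW]] W
      unfolding W_def by simp
    \<comment> \<open>Within distance \<open>\<bar>x - \<zeta>\<bar>\<close> of \<open>x\<close> the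
      point \<zeta> is avoided, so the derivative of \<open>g\<close> can be cancelled.\<close>
    have "(q has_vector_derivative
        P x * (- (\<mu> * of_real (vdiff a b g x) / of_real (g x) * W) * (inverse W * inverse W))
        + vdiff a b P x * inverse W) (at x within {a..b})"
    proof (rule has_vector_derivative_transform_within[OF dq])
      show "0 < \<bar>x - \<zeta>\<bar>" "x \<in> {a..b}" using x by auto
      fix t assume t: "t \<in> {a..b}" "dist t x < \<bar>x - \<zeta>\<bar>"
      then have "t \<noteq> \<zeta>" by (auto simp: dist_real_def)
      then show "P t * inverse (of_real (g t) powr \<mu>) = q t"
        unfolding q_def rem[OF t(1)] using g'_nz[OF t(1)] by (simp add: field_simps)
    qed
    from vdiff_eqI[OF ab x(1) this]
    have "h x = W * (P x * (- (\<mu> * of_real (vdiff a b g x) / of_real (g x) * W) * (inverse W * inverse W))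
        + vdiff a b P x * inverse W)"
      by (simp add: h_def W_def)
    also have "\<dots> = vdiff a b P x - \<mu> * (of_real (vdiff a b g x) / of_real (g x)) * P x"
      using W by (simp add: field_simps)
    finally show ?thesis .
  qed
  have h\<sigma>: "h x = \<sigma> x" if x: "x \<in> {a..b}" "x \<noteq> \<zeta>" for x
    unfolding h'[OF x] g'_over_g[OF x] \<sigma>_def P_def using x(2) by simp
  \<comment> \<open>This evaluates the \<open>Lim\<close> in the definition: \<zeta> is an interior
    point, and \<open>h\<close> agrees with the continuous function \<open>\<sigma>\<close> around
    it.\<close>
  have "(h \<longlongrightarrow> \<sigma> \<zeta>) (at \<zeta>)"
  proof (rule Lim_transform_eventually)
    have "continuous (at \<zeta> within {a..b}) \<sigma>"
      using smooth_cl_continuous_on[OF \<sigma>] \<zeta> by (simp add: continuous_on_eq_continuous_within)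
    then show "(\<sigma> \<longlongrightarrow> \<sigma> \<zeta>) (at \<zeta>)"
      using at_within_Icc_at[OF zeta] by (simp add: continuous_within)
    have "eventually (\<lambda>x. x \<in> {a<..<b}) (at \<zeta>)"
      using zeta by (intro eventually_at_in_open') auto
    then show "eventually (\<lambda>x. \<sigma> x = h x) (at \<zeta>)"
      using eventually_neq_at_within[of \<zeta> \<zeta> UNIV] by eventually_elim (simp add: h\<sigma>)
  qed
  then have lim: "Lim (at \<zeta>) h = \<sigma> \<zeta>" by (intro tendsto_Lim) auto
  have sig\<sigma>: "sigma_step a b r g \<zeta> \<mu> s x = \<sigma> x" if "x \<in> {a..b}" for x
    using that h\<sigma> lim by (simp add: sig)
  show thesis
  proof (rule that[OF P rem])
    show "smooth_cl a b (sigma_step a b r g \<zeta> \<mu> s)"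
      by (rule smooth_cl_cong[OF ab \<sigma>]) (simp add: sig\<sigma>)
    show "P \<zeta> = 0" by (simp add: P_def)
    show "sigma_step a b r g \<zeta> \<mu> s x = vdiff a b P x - \<mu> * (of_real (vdiff a b g x) / of_real (g x)) * P x"
      if "x \<in> {a..b}" "x \<noteq> \<zeta>" for x using that h' by (simp add: sig)
  qed
qed

text \<open>The coefficient of the Bessel function of order \<mu> has the shape that
  \<open>sigma_step\<close> gives away from \<zeta>. Integrating the identity exchanges order
  \<open>\<mu> - 1\<close> for order \<mu> at the cost of \<open>1 / \<omega>\<close>.\<close>

lemma mult_besselJ_phase_deriv:
  assumes P: "(P has_vector_derivative P') (at x within {a..b})" and x: "x \<in> {a..b}" "x \<noteq> \<zeta>" and \<omega>: "\<omega> > 0"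
  shows "((\<lambda>x. P x * besselJ_real \<mu> (\<omega> * g x)) has_vector_derivative
      (P' - \<mu> * (of_real (vdiff a b g x) / of_real (g x)) * P x) * besselJ_real \<mu> (\<omega> * g x)
      + of_real \<omega> * (of_real (vdiff a b g x) * P x * besselJ_real (\<mu> - 1) (\<omega> * g x))) (at x within {a..b})"
  by (rule has_vector_derivative_eq_rhs[OF has_vector_derivative_mult[OF P besselJ_phase_deriv[OF x \<omega>]]])
     (simp only: ring_distribs mult_ac, simp)

lemma remainder_by_parts:
  assumes s: "smooth_cl a b s" and \<omega>: "\<omega> > 0" and \<mu>: "Re \<mu> > - 1 / (real r + 1)"
  defines "\<sigma> \<equiv> sigma_step a b r g \<zeta> (\<mu> + 1) s" and "d \<equiv> \<lambda>x. s x - taylorT a b r s x \<zeta>"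
  shows "integral {a..b} (\<lambda>x. d x * besselJ_real \<mu> (\<omega> * g x)) =
    (d b / of_real (vdiff a b g b) * besselJ_real (\<mu> + 1) (\<omega> * g b)
      - d a / of_real (vdiff a b g a) * besselJ_real (\<mu> + 1) (\<omega> * g a)
      - integral {a..b} (\<lambda>x. \<sigma> x * besselJ_real (\<mu> + 1) (\<omega> * g x))) / of_real \<omega>"
proof -
  obtain P where P: "smooth_cl a b P"
    "\<And>x. x \<in> {a..b} \<Longrightarrow> d x = of_real (vdiff a b g x) * P x"
    "smooth_cl a b \<sigma>" "P \<zeta> = 0"
    "\<And>x. x \<in> {a..b} \<Longrightarrow> x \<noteq> \<zeta> \<Longrightarrow>
      \<sigma> x = vdiff a b P x - (\<mu> + 1) * (of_real (vdiff a b g x) / of_real (g x)) * P x"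
    using sigma_step_smooth[OF s, of "\<mu> + 1"] unfolding \<sigma>_def d_def by blast
  \<comment> \<open>Hence \<open>Re \<mu> > -1\<close>, and raising the order by one makes the
    Bessel factor continuous at \<zeta>.\<close>
  have "- 1 \<le> - 1 / (real r + 1)" by (simp add: field_simps)
  with \<mu> have "Re \<mu> > - 1" by linarith
  with \<mu> have re: "Re (\<mu> + 1) > 0" "Re (\<mu> + 1) > - 1 / (real r + 1)" by simp_all
  have "continuous_on {a..b} (\<lambda>x. of_real (x - \<zeta>) ^ r * G1 x * P x)"
    by (intro continuous_intros smooth_cl_continuous_on G1_smooth P(1))
  then have cd: "continuous_on {a..b} d"
    by (rule continuous_on_eq) (simp add: P(2) g'_eq)
  have i1: "(\<lambda>x. d x * besselJ_real \<mu> (\<omega> * g x)) integrable_on {a..b}"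
    by (rule integrable_mult_besselJ_phase[OF cd \<omega> \<mu>])
  have i2: "(\<lambda>x. \<sigma> x * besselJ_real (\<mu> + 1) (\<omega> * g x)) integrable_on {a..b}"
    by (rule integrable_mult_besselJ_phase[OF smooth_cl_continuous_on[OF P(3)] \<omega> re(2)])
  let ?I = "\<lambda>x. \<sigma> x * besselJ_real (\<mu> + 1) (\<omega> * g x) + of_real \<omega> * (d x * besselJ_real \<mu> (\<omega> * g x))"
  \<comment> \<open>The product is differentiated only off \<zeta>; its continuity there lets the
    fundamental theorem tolerate the exceptional point.\<close>
  have "(?I has_integral P b * besselJ_real (\<mu> + 1) (\<omega> * g b) - P a * besselJ_real (\<mu> + 1) (\<omega> * g a)) {a..b}"
  proof (rule fundamental_theorem_of_calculus_interior_strong[where S = "{\<zeta>}"])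
    show "continuous_on {a..b} (\<lambda>x. P x * besselJ_real (\<mu> + 1) (\<omega> * g x))"
      using re \<omega> by (intro continuous_on_mult smooth_cl_continuous_on[OF P(1)] besselJ_phase_continuous_on) auto
    fix x assume x: "x \<in> {a<..<b} - {\<zeta>}"
    then have x': "x \<in> {a..b}" "x \<noteq> \<zeta>" by auto
    have "((\<lambda>x. P x * besselJ_real (\<mu> + 1) (\<omega> * g x)) has_vector_derivative ?I x) (at x within {a..b})"
      using mult_besselJ_phase_deriv[OF smooth_cl_deriv[OF P(1) x'(1)] x' \<omega>, of "\<mu> + 1"]
      unfolding P(2)[OF x'(1)] P(5)[OF x'] by simp
    then show "((\<lambda>x. P x * besselJ_real (\<mu> + 1) (\<omega> * g x)) has_vector_derivative ?I x) (at x)"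
      using x at_within_Icc_at[of a x b] by auto
  qed (use ab in auto)
  moreover have "(?I has_integral integral {a..b} (\<lambda>x. \<sigma> x * besselJ_real (\<mu> + 1) (\<omega> * g x))
      + of_real \<omega> * integral {a..b} (\<lambda>x. d x * besselJ_real \<mu> (\<omega> * g x))) {a..b}"
    by (intro has_integral_add has_integral_mult_right integrable_integral i1 i2)
  ultimately have eq: "P b * besselJ_real (\<mu> + 1) (\<omega> * g b) - P a * besselJ_real (\<mu> + 1) (\<omega> * g a) =
     integral {a..b} (\<lambda>x. \<sigma> x * besselJ_real (\<mu> + 1) (\<omega> * g x))
      + of_real \<omega> * integral {a..b} (\<lambda>x. d x * besselJ_real \<mu> (\<omega> * g x))"
    by (rule has_integral_unique)
  have "d b / of_real (vdiff a b g b) = P b" "d a / of_real (vdiff a b g a) = P a"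
    using P(2)[of a] P(2)[of b] g'_nz[of a] g'_nz[of b] zeta by auto
  then show ?thesis using eq \<omega> by (simp add: field_simps)
qed

end

section \<open>Decay of the remainder\<close>

lemma DERIV_inverse_power':
  fixes z :: "'a::real_normed_field"
  assumes "z \<noteq> 0"
  shows "((\<lambda>z. inverse (z ^ n)) has_field_derivative - of_nat n / z ^ Suc n) (at z within S)"
proof (cases n)
  case (Suc m)
  have "((\<lambda>z. inverse (z ^ n)) has_field_derivative
      - (inverse (z ^ n) * (of_nat n * (1 * z ^ (n - Suc 0))) * inverse (z ^ n))) (at z within S)"
    by (rule DERIV_inverse'[OF DERIV_power[OF DERIV_ident]]) (use assms in simp)
  then show ?thesis
    by (rule DERIV_cong) (use assms in \<open>simp add: Suc field_simps del: of_nat_Suc\<close>)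
qed simp

section \<open>Estimates near and away from the degenerate point\<close>

context degenerate_phase
begin

text \<open>Away from \<open>\<zeta>\<close> one may integrate by parts without subtracting a Taylor polynomial, at the
  price of the singular factor \<open>|x - \<zeta>|\<^sup>-\<^sup>r\<close>.\<close>
lemma besselJ_phase_integral_away:
  assumes \<sigma>: "smooth_cl a b \<sigma>" and \<mu>: "Re \<mu> > 0"
  obtains K where "K \<ge> 0" "\<And>c d \<omega> \<delta> I. a \<le> c \<Longrightarrow> c \<le> d \<Longrightarrow> d \<le> b \<Longrightarrow> \<omega> > 0 \<Longrightarrow> \<delta> > 0 \<Longrightarrow>
     (\<And>x. x \<in> {c..d} \<Longrightarrow> \<delta> \<le> \<bar>x - \<zeta>\<bar>) \<Longrightarrow>
     ((\<lambda>x. 1 / \<bar>x - \<zeta>\<bar> ^ Suc r) has_integral I) {c..d} \<Longrightarrow> I \<le> 1 / \<delta> ^ r \<Longrightarrow>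
     norm (integral {c..d} (\<lambda>x. \<sigma> x * besselJ_real \<mu> (\<omega> * g x))) \<le> K / (\<omega> * \<delta> ^ r)"
proof -
  have bdd: "\<exists>B\<ge>0. \<forall>x\<in>{a..b}. norm (h x) \<le> B" if h: "smooth_cl a b h" for h :: "real \<Rightarrow> complex"
  proof -
    obtain B where "\<forall>x\<in>{a..b}. norm (h x) \<le> B"
      using compact_imp_bounded[OF compact_continuous_image[OF smooth_cl_continuous_on[OF h] compact_Icc]]
      unfolding bounded_iff by blast
    then show ?thesis by (intro exI[of _ "\<bar>B\<bar>"]) force
  qed
  \<comment> \<open>Chosen so that \<sigma> is the derivative of the phase times
    \<open>R x / (x - \<zeta>) ^ r\<close>.\<close>
  define R where "R x = \<sigma> x / G1 x" for x
  have R: "smooth_cl a b R" unfolding R_def by (intro smooth_intros \<sigma> G1_smooth G1_nz)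
  \<comment> \<open>This is \<open>(x - \<zeta>) ^ (r + 1)\<close> times the coefficient left by
    integrating by parts with \<open>R x / (x - \<zeta>) ^ r\<close>; it is smooth, so the
    singularity is a pure power.\<close>
  define B where "B x = (of_real (x - \<zeta>) * vdiff a b R x + - of_nat r * R x) + - (\<mu> + 1) * (R x * G1 x / G x)" for x
  have B: "smooth_cl a b B" unfolding B_def by (intro smooth_intros smooth_cl_vdiff R G_smooth G1_smooth G_nz)
  obtain CJ where CJ: "CJ \<ge> 0" "\<And>x. norm (besselJ_real (\<mu> + 1) x) \<le> CJ"
    using besselJ_real_bounded[of "\<mu> + 1"] \<mu> by auto
  obtain CR where CR: "CR \<ge> 0" "\<And>x. x \<in> {a..b} \<Longrightarrow> norm (R x) \<le> CR" using bdd[OF R] by blast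
  obtain CB where CB: "CB \<ge> 0" "\<And>x. x \<in> {a..b} \<Longrightarrow> norm (B x) \<le> CB" using bdd[OF B] by blast
  \<comment> \<open>Two endpoint values contribute the first summand, the remaining integral the
    second.\<close>
  let ?K = "2 * CR * CJ + CB * CJ"
  show thesis
  proof (rule that[of ?K])
    show "?K \<ge> 0" using CJ CR CB by simp
  next
    fix c d \<omega> \<delta> I :: real
    assume cd: "a \<le> c" "c \<le> d" "d \<le> b" and \<omega>: "\<omega> > 0" and \<delta>: "\<delta> > 0"
      and far: "\<And>x. x \<in> {c..d} \<Longrightarrow> \<delta> \<le> \<bar>x - \<zeta>\<bar>"
      and I: "((\<lambda>x. 1 / \<bar>x - \<zeta>\<bar> ^ Suc r) has_integral I) {c..d}" and I_le: "I \<le> 1 / \<delta> ^ r"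
    have sub: "x \<in> {a..b}" "x \<noteq> \<zeta>" if "x \<in> {c..d}" for x
      using that cd far[of x] \<delta> by auto
    let ?T = "\<lambda>x. complex_of_real (x - \<zeta>)"
    let ?J = "\<lambda>x. besselJ_real (\<mu> + 1) (\<omega> * g x)"
    define F where "F x = R x / ?T x ^ r * ?J x" for x
    have dF: "(F has_vector_derivative
        B x / ?T x ^ Suc r * ?J x + of_real \<omega> * (\<sigma> x * besselJ_real \<mu> (\<omega> * g x))) (at x within {a..b})"
      if x: "x \<in> {c..d}" for x
    proof -
      note x' = sub[OF x]
      have T: "?T x \<noteq> 0" using x' by simp
      have "((\<lambda>x. ?T x) has_vector_derivative of_real 1) (at x within {a..b})"
        by (rule has_vector_derivative_of_real) (auto intro!: derivative_eq_intros)
      then have dT: "((\<lambda>x. ?T x) has_vector_derivative 1) (at x within {a..b})" by simp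
      have "((\<lambda>z. inverse (z ^ r)) has_field_derivative - of_nat r / ?T x ^ Suc r) (at (?T x) within ?T ` {a..b})"
        by (rule DERIV_inverse_power'[OF T])
      from field_vector_diff_chain_within[OF dT this]
      have dI: "((\<lambda>x. inverse (?T x ^ r)) has_vector_derivative - of_nat r / ?T x ^ Suc r) (at x within {a..b})"
        by (simp add: o_def)
      have dP: "((\<lambda>x. R x / ?T x ^ r) has_vector_derivative
         (R x * (- of_nat r / ?T x ^ Suc r) + vdiff a b R x * inverse (?T x ^ r))) (at x within {a..b})"
        using has_vector_derivative_mult[OF smooth_cl_deriv[OF R x'(1)] dI] by (simp only: divide_inverse)
      have e1: "R x * (- of_nat r / ?T x ^ Suc r) + vdiff a b R x * inverse (?T x ^ r)
          - (\<mu> + 1) * (of_real (vdiff a b g x) / of_real (g x)) * (R x / ?T x ^ r) = B x / ?T x ^ Suc r"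
      proof -
        have "V * (- n / (Z * P)) + V' * inverse P - m * (H / (Z * Y)) * (V / P)
            = ((Z * V' + - n * V) + - m * (V * H / Y)) / (Z * P)"
          if "Z \<noteq> 0" "P \<noteq> 0" "Y \<noteq> 0" for V V' Z P Y H n m :: complex
          using that by (simp add: field_simps)
        then show ?thesis
          unfolding g'_over_g[OF x'] B_def power_Suc using T G_nz[OF x'(1)] by (simp only: power_not_zero not_False_eq_True)
      qed
      have e2: "of_real (vdiff a b g x) * (R x / ?T x ^ r) = \<sigma> x"
        unfolding g'_eq[OF x'(1)] R_def using T G1_nz[OF x'(1)] by simp
      from mult_besselJ_phase_deriv[OF dP x' \<omega>, of "\<mu> + 1"] show ?thesis
        unfolding e1 e2 F_def[abs_def] by simp
    qed
    have Fint: "((\<lambda>x. B x / ?T x ^ Suc r * ?J x + of_real \<omega> * (\<sigma> x * besselJ_real \<mu> (\<omega> * g x)))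
        has_integral F d - F c) {c..d}"
      by (rule fundamental_theorem_of_calculus[OF cd(2)])
         (rule has_vector_derivative_within_subset[OF dF], use cd in auto)
    have "continuous_on {c..d} (\<lambda>x. B x / ?T x ^ Suc r * ?J x)"
      using sub \<mu> \<omega>
      by (intro continuous_intros continuous_on_subset[OF smooth_cl_continuous_on[OF B]] besselJ_phase_continuous_on) auto
    then have BI: "(\<lambda>x. B x / ?T x ^ Suc r * ?J x) integrable_on {c..d}"
      by (rule integrable_continuous_interval)
    have "continuous_on {c..d} (\<lambda>x. \<sigma> x * besselJ_real \<mu> (\<omega> * g x))"
      using sub \<mu> \<omega>
      by (intro continuous_intros continuous_on_subset[OF smooth_cl_continuous_on[OF \<sigma>]] besselJ_phase_continuous_on) auto
    then have \<sigma>I: "(\<lambda>x. \<sigma> x * besselJ_real \<mu> (\<omega> * g x)) integrable_on {c..d}"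
      by (rule integrable_continuous_interval)
    let ?X = "integral {c..d} (\<lambda>x. \<sigma> x * besselJ_real \<mu> (\<omega> * g x))"
    let ?Y = "integral {c..d} (\<lambda>x. B x / ?T x ^ Suc r * ?J x)"
    have "F d - F c = ?Y + of_real \<omega> * ?X"
      by (rule has_integral_unique[OF Fint])
         (intro has_integral_add has_integral_mult_right integrable_integral BI \<sigma>I)
    then have eq: "of_real \<omega> * ?X = F d - F c - ?Y" by simp
    have "\<omega> * norm ?X = norm (F d - F c - ?Y)"
      using \<omega> arg_cong[OF eq, of norm, unfolded norm_mult norm_of_real] by (simp only: abs_of_pos)
    also have "\<dots> \<le> norm (F d) + norm (F c) + norm ?Y"
      by (meson add_mono norm_triangle_ineq4 order_refl order_trans)
    also have "\<dots> \<le> CR * CJ / \<delta> ^ r + CR * CJ / \<delta> ^ r + CB * CJ / \<delta> ^ r"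
    proof (intro add_mono)
      have nF: "norm (F x) \<le> CR * CJ / \<delta> ^ r" if x: "x \<in> {c..d}" for x
      proof -
        have "norm (R x / ?T x ^ r) \<le> CR / \<delta> ^ r"
          unfolding norm_divide norm_power norm_of_real
          using CR sub(1)[OF x] far[OF x] \<delta> by (intro frac_le power_mono) auto
        from mult_mono[OF this CJ(2)] show ?thesis
          unfolding F_def norm_mult using CR(1) \<delta> by (simp del: of_real_mult)
      qed
      show "norm (F d) \<le> CR * CJ / \<delta> ^ r" "norm (F c) \<le> CR * CJ / \<delta> ^ r"
        using nF cd by auto
      have "norm ?Y \<le> integral {c..d} (\<lambda>x. CB * CJ * (1 / \<bar>x - \<zeta>\<bar> ^ Suc r))"
      proof (rule integral_norm_bound_integral[OF BI])
        show "(\<lambda>x. CB * CJ * (1 / \<bar>x - \<zeta>\<bar> ^ Suc r)) integrable_on {c..d}"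
          using I by (intro integrable_on_mult_right) blast
        fix x assume x: "x \<in> {c..d}"
        have "norm (B x / ?T x ^ Suc r) \<le> CB * (1 / \<bar>x - \<zeta>\<bar> ^ Suc r)"
          using CB(2)[OF sub(1)[OF x]] by (simp add: norm_divide norm_power norm_mult divide_right_mono del: of_real_diff)
        from mult_mono[OF this CJ(2)] CB(1)
        show "norm (B x / ?T x ^ Suc r * ?J x) \<le> CB * CJ * (1 / \<bar>x - \<zeta>\<bar> ^ Suc r)"
          unfolding norm_mult by (simp add: mult_ac del: of_real_mult)
      qed
      also have "\<dots> = CB * CJ * I" using has_integral_mult_right[OF I] by (rule integral_unique)
      also have "\<dots> \<le> CB * CJ * (1 / \<delta> ^ r)"
        using I_le CB CJ by (intro mult_left_mono) auto
      finally show "norm ?Y \<le> CB * CJ / \<delta> ^ r" by simp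
    qed
    also have "\<dots> = ?K / \<delta> ^ r" by (simp add: add_divide_distrib)
    finally show "norm ?X \<le> ?K / (\<omega> * \<delta> ^ r)"
      using \<omega> \<delta> by (simp add: field_simps)
  qed
qed

text \<open>The antiderivative is \<open>- 1 / (r * (x - \<zeta>) ^ r)\<close>. The far endpoint
  contributes with a negative sign, and \<open>r \<ge> 1\<close> allows the factor
  \<open>1 / r\<close> to be dropped from the bound.\<close>

lemma inverse_power_integral_right:
  assumes "\<delta> > 0" "\<zeta> + \<delta> \<le> b"
  obtains I where "((\<lambda>x. 1 / \<bar>x - \<zeta>\<bar> ^ Suc r) has_integral I) {\<zeta> + \<delta>..b}" "I \<le> 1 / \<delta> ^ r"
proof
  have "((\<lambda>x. 1 / \<bar>x - \<zeta>\<bar> ^ Suc r) has_integral (- 1 / (real r * (b - \<zeta>) ^ r)) - (- 1 / (real r * (\<zeta> + \<delta> - \<zeta>) ^ r))) {\<zeta> + \<delta>..b}"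
  proof (rule fundamental_theorem_of_calculus[OF assms(2)])
    fix x assume "x \<in> {\<zeta> + \<delta>..b}"
    then have x: "x - \<zeta> > 0" using assms by auto
    show "((\<lambda>x. - 1 / (real r * (x - \<zeta>) ^ r)) has_vector_derivative 1 / \<bar>x - \<zeta>\<bar> ^ Suc r) (at x within {\<zeta> + \<delta>..b})"
    proof -
      have d: "((\<lambda>x. x - \<zeta>) has_real_derivative 1) (at x within {\<zeta> + \<delta>..b})"
        by (auto intro!: derivative_eq_intros)
      have "((\<lambda>x. - 1 / real r * inverse ((x - \<zeta>) ^ r)) has_real_derivative 1 / (x - \<zeta>) ^ Suc r) (at x within {\<zeta> + \<delta>..b})"
        by (rule DERIV_cong[OF DERIV_cmult[OF DERIV_chain2[OF DERIV_inverse_power' d]]]) (use x r in auto)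
      then show ?thesis
        unfolding has_real_derivative_iff_has_vector_derivative[symmetric] using x by (simp add: divide_inverse mult_ac)
    qed
  qed
  then show "((\<lambda>x. 1 / \<bar>x - \<zeta>\<bar> ^ Suc r) has_integral 1 / (real r * \<delta> ^ r) - 1 / (real r * (b - \<zeta>) ^ r)) {\<zeta> + \<delta>..b}"
    by simp
  have "1 / (real r * \<delta> ^ r) \<le> 1 / (1 * \<delta> ^ r)"
    using r assms by (intro divide_left_mono mult_right_mono) auto
  moreover have "1 / (real r * (b - \<zeta>) ^ r) \<ge> 0" using zeta by simp
  ultimately show "1 / (real r * \<delta> ^ r) - 1 / (real r * (b - \<zeta>) ^ r) \<le> 1 / \<delta> ^ r" by linarith
qed

lemma inverse_power_integral_left:
  assumes "\<delta> > 0" "a \<le> \<zeta> - \<delta>"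
  obtains I where "((\<lambda>x. 1 / \<bar>x - \<zeta>\<bar> ^ Suc r) has_integral I) {a..\<zeta> - \<delta>}" "I \<le> 1 / \<delta> ^ r"
proof
  have "((\<lambda>x. 1 / \<bar>x - \<zeta>\<bar> ^ Suc r) has_integral 1 / (real r * (\<zeta> - (\<zeta> - \<delta>)) ^ r) - 1 / (real r * (\<zeta> - a) ^ r)) {a..\<zeta> - \<delta>}"
  proof (rule fundamental_theorem_of_calculus[OF assms(2)])
    fix x assume "x \<in> {a..\<zeta> - \<delta>}"
    then have x: "\<zeta> - x > 0" "\<bar>x - \<zeta>\<bar> = \<zeta> - x" using assms by auto
    show "((\<lambda>x. 1 / (real r * (\<zeta> - x) ^ r)) has_vector_derivative 1 / \<bar>x - \<zeta>\<bar> ^ Suc r) (at x within {a..\<zeta> - \<delta>})"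
    proof -
      have d: "((\<lambda>x. \<zeta> - x) has_real_derivative - 1) (at x within {a..\<zeta> - \<delta>})"
        by (auto intro!: derivative_eq_intros)
      have "((\<lambda>x. 1 / real r * inverse ((\<zeta> - x) ^ r)) has_real_derivative 1 / (\<zeta> - x) ^ Suc r) (at x within {a..\<zeta> - \<delta>})"
        by (rule DERIV_cong[OF DERIV_cmult[OF DERIV_chain2[OF DERIV_inverse_power' d]]]) (use x(1) r in auto)
      then show ?thesis
        unfolding has_real_derivative_iff_has_vector_derivative[symmetric] x(2) by (simp add: divide_inverse mult_ac)
    qed
  qed
  then show "((\<lambda>x. 1 / \<bar>x - \<zeta>\<bar> ^ Suc r) has_integral 1 / (real r * \<delta> ^ r) - 1 / (real r * (\<zeta> - a) ^ r)) {a..\<zeta> - \<delta>}"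
    by simp
  have "1 / (real r * \<delta> ^ r) \<le> 1 / (1 * \<delta> ^ r)"
    using r assms by (intro divide_left_mono mult_right_mono) auto
  moreover have "1 / (real r * (\<zeta> - a) ^ r) \<ge> 0" using zeta by simp
  ultimately show "1 / (real r * \<delta> ^ r) - 1 / (real r * (\<zeta> - a) ^ r) \<le> 1 / \<delta> ^ r" by linarith
qed

lemma powr_neg_inverse_tendsto_0: "((\<lambda>\<omega>. \<omega> powr (- (1 / (real r + 1)))) \<longlongrightarrow> 0) at_top"
  by (rule tendsto_neg_powr) (auto intro: filterlim_ident)

text \<open>Split at distance \<open>\<delta> = \<omega>\<^sup>-\<^sup>1\<^sup>/\<^sup>(\<^sup>r\<^sup>+\<^sup>1\<^sup>)\<close> from \<open>\<zeta>\<close>, so that \<open>1 / (\<omega> \<delta>\<^sup>r) = \<delta>\<close>: the middle part is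
  bounded trivially, the outer ones by parts.\<close>
lemma besselJ_phase_integral_bigo:
  assumes \<sigma>: "smooth_cl a b \<sigma>" and \<mu>: "Re \<mu> > 0"
  shows "(\<lambda>\<omega>. integral {a..b} (\<lambda>x. \<sigma> x * besselJ_real \<mu> (\<omega> * g x)))
    \<in> O[at_top](\<lambda>\<omega>. of_real (\<omega> powr (- (1 / (real r + 1)))))"
proof -
  obtain K where K: "K \<ge> 0" "\<And>c d \<omega> \<delta> I. a \<le> c \<Longrightarrow> c \<le> d \<Longrightarrow> d \<le> b \<Longrightarrow> \<omega> > 0 \<Longrightarrow> \<delta> > 0 \<Longrightarrow>
     (\<And>x. x \<in> {c..d} \<Longrightarrow> \<delta> \<le> \<bar>x - \<zeta>\<bar>) \<Longrightarrow>
     ((\<lambda>x. 1 / \<bar>x - \<zeta>\<bar> ^ Suc r) has_integral I) {c..d} \<Longrightarrow> I \<le> 1 / \<delta> ^ r \<Longrightarrow>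
     norm (integral {c..d} (\<lambda>x. \<sigma> x * besselJ_real \<mu> (\<omega> * g x))) \<le> K / (\<omega> * \<delta> ^ r)"
    using besselJ_phase_integral_away[OF \<sigma> \<mu>] by blast
  obtain CJ where CJ: "CJ \<ge> 0" "\<And>x. norm (besselJ_real \<mu> x) \<le> CJ"
    using besselJ_real_bounded[OF \<mu>] by auto
  obtain CS where CS: "\<And>x. x \<in> {a..b} \<Longrightarrow> norm (\<sigma> x) \<le> CS"
    using compact_imp_bounded[OF compact_continuous_image[OF smooth_cl_continuous_on[OF \<sigma>] compact_Icc]]
    unfolding bounded_iff by blast
  have CS0: "CS \<ge> 0" using order_trans[OF norm_ge_zero CS[of a]] ab by simp
  let ?\<delta> = "\<lambda>\<omega>. \<omega> powr (- (1 / (real r + 1)))"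
  \<comment> \<open>For large \<omega> the middle interval fits inside
    \<open>{a..b}\<close>.\<close>
  have "eventually (\<lambda>\<omega>. ?\<delta> \<omega> < min (\<zeta> - a) (b - \<zeta>)) at_top"
    using zeta by (intro order_tendstoD(2)[OF powr_neg_inverse_tendsto_0]) auto
  with eventually_gt_at_top[of "0::real"]
  have "eventually (\<lambda>\<omega>. norm (integral {a..b} (\<lambda>x. \<sigma> x * besselJ_real \<mu> (\<omega> * g x)))
      \<le> (2 * K + 2 * CS * CJ) * norm (complex_of_real (?\<delta> \<omega>))) at_top"
  proof eventually_elim
    case (elim \<omega>)
    define \<delta> where "\<delta> = ?\<delta> \<omega>"
    have \<delta>: "\<delta> > 0" "a \<le> \<zeta> - \<delta>" "\<zeta> + \<delta> \<le> b" using elim by (auto simp: \<delta>_def)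
    have "\<delta> ^ Suc r = \<delta> powr real (Suc r)" using \<delta> by (simp only: powr_realpow)
    also have "\<dots> = \<omega> powr (- 1)" unfolding \<delta>_def powr_powr by (rule arg_cong[where f = "\<lambda>p. \<omega> powr p"]) (simp add: field_simps)
    also have "\<dots> = 1 / \<omega>" using elim by (simp add: powr_minus_divide)
    finally have \<delta>\<omega>: "\<omega> * \<delta> ^ r = 1 / \<delta>" using elim \<delta> by (simp add: field_simps)
    let ?f = "\<lambda>x. \<sigma> x * besselJ_real \<mu> (\<omega> * g x)"
    have "- 1 / (real r + 1) < 0" by simp
    with \<mu> have "Re \<mu> > - 1 / (real r + 1)" by linarith
    then have int: "?f integrable_on {a..b}"
      using elim by (intro integrable_mult_besselJ_phase smooth_cl_continuous_on[OF \<sigma>])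
    have int': "?f integrable_on {c..d}" if "a \<le> c" "d \<le> b" for c d
      by (rule integrable_on_subinterval[OF int]) (use that in auto)
    have split: "integral {a..b} ?f = integral {a..\<zeta> - \<delta>} ?f + integral {\<zeta> - \<delta>..\<zeta> + \<delta>} ?f + integral {\<zeta> + \<delta>..b} ?f"
      using Henstock_Kurzweil_Integration.integral_combine[of a "\<zeta> - \<delta>" b ?f]
        Henstock_Kurzweil_Integration.integral_combine[of "\<zeta> - \<delta>" "\<zeta> + \<delta>" b ?f] int int' \<delta>
      by (simp add: add.assoc del: of_real_mult)
    obtain I1 where I1: "((\<lambda>x. 1 / \<bar>x - \<zeta>\<bar> ^ Suc r) has_integral I1) {a..\<zeta> - \<delta>}" "I1 \<le> 1 / \<delta> ^ r"
      using inverse_power_integral_left[OF \<delta>(1,2)] by blast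
    have 1: "norm (integral {a..\<zeta> - \<delta>} ?f) \<le> K / (\<omega> * \<delta> ^ r)"
      by (rule K(2)[OF _ _ _ _ _ _ I1]) (use elim \<delta> zeta in auto)
    obtain I2 where I2: "((\<lambda>x. 1 / \<bar>x - \<zeta>\<bar> ^ Suc r) has_integral I2) {\<zeta> + \<delta>..b}" "I2 \<le> 1 / \<delta> ^ r"
      using inverse_power_integral_right[OF \<delta>(1,3)] by blast
    have 2: "norm (integral {\<zeta> + \<delta>..b} ?f) \<le> K / (\<omega> * \<delta> ^ r)"
      by (rule K(2)[OF _ _ _ _ _ _ I2]) (use elim \<delta> zeta in auto)
    have "(?f has_integral integral {\<zeta> - \<delta>..\<zeta> + \<delta>} ?f) (cbox (\<zeta> - \<delta>) (\<zeta> + \<delta>))"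
      using integrable_integral[OF int'] \<delta> by simp
    then have "norm (integral {\<zeta> - \<delta>..\<zeta> + \<delta>} ?f) \<le> CS * CJ * measure lborel (cbox (\<zeta> - \<delta>) (\<zeta> + \<delta>))"
    proof (rule has_integral_bound[rotated])
      fix x assume "x \<in> cbox (\<zeta> - \<delta>) (\<zeta> + \<delta>)"
      then have "x \<in> {a..b}" using \<delta> by auto
      then show "norm (?f x) \<le> CS * CJ"
        unfolding norm_mult by (intro mult_mono CS CJ CS0 norm_ge_zero)
    qed (use CS0 CJ in auto)
    then have 3: "norm (integral {\<zeta> - \<delta>..\<zeta> + \<delta>} ?f) \<le> CS * CJ * (2 * \<delta>)"
      using \<delta> by simp
    have "norm (integral {a..b} ?f) \<le> norm (integral {a..\<zeta> - \<delta>} ?f) + norm (integral {\<zeta> - \<delta>..\<zeta> + \<delta>} ?f) + norm (integral {\<zeta> + \<delta>..b} ?f)"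
      unfolding split by (meson add_mono norm_triangle_ineq order_refl order_trans)
    also have "\<dots> \<le> K * \<delta> + CS * CJ * (2 * \<delta>) + K * \<delta>"
      using 1 2 3 unfolding \<delta>\<omega> by simp
    also have "\<dots> = (2 * K + 2 * CS * CJ) * \<delta>" by (simp add: algebra_simps)
    finally show ?case using \<delta>(1) by (simp add: \<delta>_def)
  qed
  then show ?thesis by (rule bigoI)
qed

text \<open>The decay of order 1/2 suffices because \<open>r \<ge> 1\<close> gives
  \<open>1 / (r + 1) \<le> 1 / 2\<close>.\<close>

lemma besselJ_linear_bigo:
  assumes "c \<noteq> 0"
  shows "(\<lambda>\<omega>. besselJ_real \<mu> (\<omega> * c)) \<in> O[at_top](\<lambda>\<omega>. of_real (\<omega> powr (- (1 / (real r + 1)))))"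
proof -
  obtain C where C: "C \<ge> 0" "\<And>x. \<bar>x\<bar> \<ge> 1 \<Longrightarrow> norm (besselJ_real \<mu> x) \<le> C / sqrt \<bar>x\<bar>"
    using besselJ_real_decay[of \<mu>] by blast
  \<comment> \<open>Two thresholds: \<open>\<omega> \<ge> 1 / \<bar>c\<bar>\<close> puts the
    argument into the range of the decay estimate, and \<open>\<omega> \<ge> 1\<close> makes powers
    of \<omega> increase with the exponent.\<close>
  have "eventually (\<lambda>\<omega>. norm (besselJ_real \<mu> (\<omega> * c))
      \<le> (C / sqrt \<bar>c\<bar>) * norm (complex_of_real (\<omega> powr (- (1 / (real r + 1)))))) at_top"
    using eventually_ge_at_top[of "1::real"] eventually_ge_at_top[of "1 / \<bar>c\<bar>"]
  proof eventually_elim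
    case (elim \<omega>)
    have "\<bar>\<omega> * c\<bar> \<ge> 1" using elim assms by (simp add: abs_mult field_simps)
    note decay = C(2)[OF this]
    have "1 / sqrt \<omega> = \<omega> powr (- (1 / 2))"
      using elim by (simp add: powr_minus_divide powr_half_sqrt)
    also have "\<dots> \<le> \<omega> powr (- (1 / (real r + 1)))"
      using elim r by (intro powr_mono) (auto simp: field_simps)
    finally have le: "1 / sqrt \<omega> \<le> \<omega> powr (- (1 / (real r + 1)))" .
    from decay have "norm (besselJ_real \<mu> (\<omega> * c)) \<le> C / sqrt \<bar>c\<bar> * (1 / sqrt \<omega>)"
      using elim by (simp add: abs_mult real_sqrt_mult mult_ac)
    also have "\<dots> \<le> C / sqrt \<bar>c\<bar> * \<omega> powr (- (1 / (real r + 1)))"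
      using C(1) by (intro mult_left_mono le) auto
    finally show ?case by simp
  qed
  then show ?thesis by (rule bigoI)
qed

text \<open>One integration by parts yields the factor \<open>1 / \<omega>\<close>. It also raises
  the order to positive real part, so both the boundary terms and the new integral have the
  remaining decay.\<close>

lemma remainder_bigo:
  assumes s: "smooth_cl a b s" and \<mu>: "Re \<mu> > - 1 / (real r + 1)"
  shows "(\<lambda>\<omega>. integral {a..b} (\<lambda>x. (s x - taylorT a b r s x \<zeta>) * besselJ_real \<mu> (\<omega> * g x)))
    \<in> O[at_top](\<lambda>\<omega>. of_real (\<omega> powr (- 1 - 1 / (real r + 1))))"
proof -
  let ?\<sigma> = "sigma_step a b r g \<zeta> (\<mu> + 1) s"
  define d where "d x = s x - taylorT a b r s x \<zeta>" for x
  let ?p = "\<lambda>\<omega>. complex_of_real (\<omega> powr (- (1 / (real r + 1))))"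
  have \<sigma>: "smooth_cl a b ?\<sigma>" using sigma_step_smooth[OF s, of "\<mu> + 1"] by blast
  have "- 1 \<le> - 1 / (real r + 1)" by (simp add: field_simps)
  with \<mu> have "Re \<mu> > - 1" by linarith
  then have re: "Re (\<mu> + 1) > 0" by simp
  define A where "A \<omega> = d b / of_real (vdiff a b g b) * besselJ_real (\<mu> + 1) (\<omega> * g b)
      - d a / of_real (vdiff a b g a) * besselJ_real (\<mu> + 1) (\<omega> * g a)
      - integral {a..b} (\<lambda>x. ?\<sigma> x * besselJ_real (\<mu> + 1) (\<omega> * g x))" for \<omega>
  have A: "A \<in> O[at_top](?p)"
  proof -
    have lin: "(\<lambda>\<omega>. k * besselJ_real (\<mu> + 1) (\<omega> * g c)) \<in> O[at_top](?p)" if "c \<in> {a, b}" for k c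
    proof -
      have "g c \<noteq> 0" using that zeta by (intro g_nz) auto
      then show ?thesis unfolding cmult_in_bigo_iff using besselJ_linear_bigo by blast
    qed
    show ?thesis
      unfolding A_def by (intro sum_in_bigo besselJ_phase_integral_bigo \<sigma> re lin) auto
  qed
  have 1: "eventually (\<lambda>\<omega>. integral {a..b} (\<lambda>x. d x * besselJ_real \<mu> (\<omega> * g x)) = A \<omega> * of_real (1 / \<omega>)) at_top"
    using eventually_gt_at_top[of 0]
  proof eventually_elim
    case (elim \<omega>)
    then show ?case using remainder_by_parts[OF s elim \<mu>] unfolding A_def d_def by (simp add: divide_inverse)
  qed
  have 2: "(\<lambda>\<omega>. A \<omega> * of_real (1 / \<omega>)) \<in> O[at_top](\<lambda>\<omega>. ?p \<omega> * of_real (1 / \<omega>))"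
    by (intro landau_o.big.mult A) simp
  have 3: "eventually (\<lambda>\<omega>. ?p \<omega> * of_real (1 / \<omega>) = of_real (\<omega> powr (- 1 - 1 / (real r + 1)))) at_top"
    using eventually_gt_at_top[of 0]
  proof eventually_elim
    case (elim \<omega>)
    have "\<omega> powr (- 1 - 1 / (real r + 1)) = \<omega> powr (- (1 / (real r + 1))) * \<omega> powr (- 1)"
      unfolding powr_add[symmetric] by (rule arg_cong[where f = "\<lambda>p. \<omega> powr p"]) simp
    also have "\<omega> powr (- 1) = 1 / \<omega>" using elim by (simp add: powr_minus_divide)
    finally show ?case by simp
  qed
  show ?thesis
    unfolding landau_o.big.in_cong[OF 1[unfolded d_def]] landau_o.big.cong[OF 3, symmetric] by (rule 2)
qed

section \<open>The exact remainder of the partial expansion\<close>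

lemma sigma_hat_smooth: "smooth_cl a b f \<Longrightarrow> smooth_cl a b (sigma_hat a b r \<nu> g \<zeta> f k)"
proof (induction k)
  case 0
  then show ?case using smooth_cl_of_real(1)[OF ab] by simp
next
  case (Suc k)
  then show ?case
    unfolding sigma_hat_Suc using sigma_step_smooth[of _ "\<nu> + of_nat (Suc k)"] by blast
qed

lemma taylorT_continuous_on: "continuous_on {a..b} (\<lambda>x. taylorT a b r s x \<zeta>)"
  unfolding taylorT_def by (intro continuous_intros)

text \<open>The monomials of the Taylor polynomial integrate to the moments; what is left vanishes
  at \<zeta> to the order that integration by parts requires.\<close>

lemma integral_taylorT_split:
  assumes s: "smooth_cl a b s" and \<omega>: "\<omega> > 0" and \<mu>: "Re \<mu> > - 1 / (real r + 1)"
  shows "integral {a..b} (\<lambda>x. s x * besselJ_real \<mu> (\<omega> * g x)) =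
    (\<Sum>j\<le>r. vdiffs a b j s \<zeta> / fact j * Mmom a b g j \<zeta> \<mu> \<omega>)
    + integral {a..b} (\<lambda>x. (s x - taylorT a b r s x \<zeta>) * besselJ_real \<mu> (\<omega> * g x))"
proof -
  let ?J = "\<lambda>x. besselJ_real \<mu> (\<omega> * g x)"
  have m: "(\<lambda>x. of_real ((x - \<zeta>) ^ j) * ?J x) integrable_on {a..b}" for j
    by (intro integrable_mult_besselJ_phase \<omega> \<mu> continuous_intros)
  have d: "(\<lambda>x. (s x - taylorT a b r s x \<zeta>) * ?J x) integrable_on {a..b}"
    by (intro integrable_mult_besselJ_phase \<omega> \<mu> continuous_intros taylorT_continuous_on smooth_cl_continuous_on s)
  have "((\<lambda>x. (\<Sum>j\<le>r. vdiffs a b j s \<zeta> / fact j * (of_real ((x - \<zeta>) ^ j) * ?J x)) + (s x - taylorT a b r s x \<zeta>) * ?J x)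
     has_integral (\<Sum>j\<le>r. vdiffs a b j s \<zeta> / fact j * Mmom a b g j \<zeta> \<mu> \<omega>)
    + integral {a..b} (\<lambda>x. (s x - taylorT a b r s x \<zeta>) * ?J x)) {a..b}"
    unfolding Mmom_def
    by (intro has_integral_add has_integral_sum has_integral_mult_right integrable_integral m d finite_atMost)
  moreover have "(\<Sum>j\<le>r. vdiffs a b j s \<zeta> / fact j * (of_real ((x - \<zeta>) ^ j) * ?J x)) + (s x - taylorT a b r s x \<zeta>) * ?J x
      = s x * ?J x" for x
  proof -
    have "(\<Sum>j\<le>r. vdiffs a b j s \<zeta> / fact j * (of_real ((x - \<zeta>) ^ j) * ?J x)) = taylorT a b r s x \<zeta> * ?J x"
      unfolding taylorT_def sum_distrib_right by (simp only: mult.assoc)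
    then show ?thesis by (simp add: algebra_simps)
  qed
  ultimately show ?thesis by (simp add: integral_unique)
qed

text \<open>An identity, not an estimate. Passing from \<open>N\<close> to \<open>Suc N\<close>
  integrates the error by parts, which gives the boundary terms, and then splits the new integral
  into moments and the next error.\<close>

lemma partial_exp_remainder:
  assumes f: "smooth_cl a b f" and \<omega>: "\<omega> > 0" and \<nu>: "Re \<nu> > - 1 / (real r + 1)"
  shows "Hnu a b \<nu> f g \<omega> - partial_exp a b r \<nu> g \<zeta> f N \<omega> = 1 / (- of_real \<omega>) ^ N *
    integral {a..b} (\<lambda>x. (sigma_hat a b r \<nu> g \<zeta> f N x - taylorT a b r (sigma_hat a b r \<nu> g \<zeta> f N) x \<zeta>)
       * besselJ_real (\<nu> + of_nat N) (\<omega> * g x))"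
proof (induction N)
  case 0
  show ?case
    using integral_taylorT_split[OF sigma_hat_smooth[OF f, of \<nu> 0] \<omega> \<nu>]
    by (simp add: Hnu_def partial_exp_def)
next
  case (Suc N)
  let ?s = "sigma_hat a b r \<nu> g \<zeta> f"
  let ?W = "- complex_of_real \<omega>"
  define R where "R k = integral {a..b} (\<lambda>x. (?s k x - taylorT a b r (?s k) x \<zeta>) * besselJ_real (\<nu> + of_nat k) (\<omega> * g x))" for k
  define M where "M k = (\<Sum>j\<le>r. vdiffs a b j (?s k) \<zeta> / fact j * Mmom a b g j \<zeta> (\<nu> + of_nat k) \<omega>)" for k
  define B where "B k = bcoef a b r \<nu> g \<zeta> f k b * besselJ_real (\<nu> + of_nat k) (\<omega> * g b)
         - bcoef a b r \<nu> g \<zeta> f k a * besselJ_real (\<nu> + of_nat k) (\<omega> * g a)" for k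
  have re: "Re (\<nu> + of_nat k) > - 1 / (real r + 1)" for k using \<nu> by (auto intro: less_le_trans)
  have p: "partial_exp a b r \<nu> g \<zeta> f n \<omega> = (\<Sum>k\<le>n. 1 / ?W ^ k * M k) - (\<Sum>k\<in>{1..n}. 1 / ?W ^ k * B k)" for n
    unfolding partial_exp_def M_def B_def ..
  have e: "\<nu> + of_nat N + 1 = \<nu> + of_nat (Suc N)" by simp
  have "R N = (B (Suc N) - integral {a..b} (\<lambda>x. ?s (Suc N) x * besselJ_real (\<nu> + of_nat (Suc N)) (\<omega> * g x))) / of_real \<omega>"
    using remainder_by_parts[OF sigma_hat_smooth[OF f] \<omega> re[of N], of \<nu> N]
    unfolding e sigma_hat_Suc[symmetric] R_def B_def bcoef_def Let_def by simp
  also have "integral {a..b} (\<lambda>x. ?s (Suc N) x * besselJ_real (\<nu> + of_nat (Suc N)) (\<omega> * g x)) = M (Suc N) + R (Suc N)"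
    unfolding M_def R_def by (rule integral_taylorT_split[OF sigma_hat_smooth[OF f] \<omega> re])
  \<comment> \<open>The minus sign in front of the new integral is absorbed into the denominator;
    this is where the powers of \<open>- \<omega>\<close> come from.\<close>
  finally have RN: "R N = (M (Suc N) + R (Suc N) - B (Suc N)) / ?W"
    using \<omega> by (simp add: field_simps)
  have "Hnu a b \<nu> f g \<omega> - partial_exp a b r \<nu> g \<zeta> f (Suc N) \<omega> =
     (Hnu a b \<nu> f g \<omega> - partial_exp a b r \<nu> g \<zeta> f N \<omega>) - 1 / ?W ^ Suc N * M (Suc N) + 1 / ?W ^ Suc N * B (Suc N)"
    unfolding p by simp
  also have "\<dots> = 1 / ?W ^ N * R N - 1 / ?W ^ Suc N * M (Suc N) + 1 / ?W ^ Suc N * B (Suc N)"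
    unfolding Suc.IH R_def ..
  also have "\<dots> = 1 / ?W ^ Suc N * R (Suc N)"
    unfolding RN by (simp add: divide_inverse ring_distribs mult_ac)
  finally show ?case unfolding R_def .
qed

text \<open>The rate matches the bound for the first omitted term: the power
  \<open>\<omega>\<^sup>-\<^sup>(\<^sup>N\<^sup>+\<^sup>1\<^sup>)\<close> times moments and boundary
  values, all of which are
  \<open>O(\<omega>\<^sup>-\<^sup>1\<^sup>/\<^sup>(\<^sup>r\<^sup>+\<^sup>1\<^sup>))\<close>.\<close>

lemma partial_exp_bigo:
  assumes f: "smooth_cl a b f" and \<nu>: "Re \<nu> > - 1 / (real r + 1)"
  shows "(\<lambda>\<omega>. Hnu a b \<nu> f g \<omega> - partial_exp a b r \<nu> g \<zeta> f N \<omega>)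
    \<in> O[at_top](\<lambda>\<omega>. of_real (\<omega> powr (- (real N + 1) - 1 / (real r + 1))))"
proof -
  let ?s = "sigma_hat a b r \<nu> g \<zeta> f N"
  let ?W = "\<lambda>\<omega>. 1 / (- complex_of_real \<omega>) ^ N"
  let ?q = "\<lambda>\<omega>. complex_of_real (\<omega> powr (- 1 - 1 / (real r + 1)))"
  define R where "R \<omega> = integral {a..b} (\<lambda>x. (?s x - taylorT a b r ?s x \<zeta>) * besselJ_real (\<nu> + of_nat N) (\<omega> * g x))" for \<omega>
  have "Re (\<nu> + of_nat N) > - 1 / (real r + 1)" using \<nu> by (auto intro: less_le_trans)
  then have R: "R \<in> O[at_top](?q)"
    unfolding R_def by (intro remainder_bigo sigma_hat_smooth f)
  have W: "?W \<in> O[at_top](\<lambda>\<omega>. of_real (1 / \<omega> ^ N))"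
    by (intro bigoI[of _ 1] always_eventually allI) (simp add: norm_divide norm_power)
  have 1: "eventually (\<lambda>\<omega>. Hnu a b \<nu> f g \<omega> - partial_exp a b r \<nu> g \<zeta> f N \<omega> = ?W \<omega> * R \<omega>) at_top"
    using eventually_gt_at_top[of 0] by eventually_elim (simp only: partial_exp_remainder[OF f _ \<nu>] R_def)
  have 2: "(\<lambda>\<omega>. ?W \<omega> * R \<omega>) \<in> O[at_top](\<lambda>\<omega>. of_real (1 / \<omega> ^ N) * ?q \<omega>)"
    by (intro landau_o.big.mult W R)
  have 3: "eventually (\<lambda>\<omega>. of_real (1 / \<omega> ^ N) * ?q \<omega> = of_real (\<omega> powr (- (real N + 1) - 1 / (real r + 1)))) at_top"
    using eventually_gt_at_top[of 0]
  proof eventually_elim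
    case (elim \<omega>)
    have "1 / \<omega> ^ N = \<omega> powr (- real N)" using elim by (simp add: powr_minus_divide powr_realpow)
    then have "1 / \<omega> ^ N * \<omega> powr (- 1 - 1 / (real r + 1)) = \<omega> powr (- real N + (- 1 - 1 / (real r + 1)))"
      by (simp only: powr_add)
    also have "- real N + (- 1 - 1 / (real r + 1)) = - (real N + 1) - 1 / (real r + 1)" by simp
    finally show ?case by (simp only: of_real_mult[symmetric])
  qed
  show ?thesis
    unfolding landau_o.big.in_cong[OF 1] landau_o.big.cong[OF 3, symmetric] by (rule 2)
qed

end

section \<open>From the derivative conditions on the phase to its factorisation\<close>

theorem theorem3p1:
  fixes r :: nat and \<nu> :: complex and a b \<zeta> :: real and f g :: "real \<Rightarrow> real"
  assumes r: "r \<ge> 1"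
    and nu: "Re \<nu> > - 1 / (real r + 1)"
    and ab: "a < b"
    and f_smooth: "smooth_cl a b f"
    and g_smooth: "smooth_cl a b g"
    and zeta: "\<zeta> \<in> {a<..<b}"
    and g_zero: "\<forall>j\<le>r. vdiffs a b j g \<zeta> = 0"
    and g_nondeg: "vdiffs a b (Suc r) g \<zeta> \<noteq> 0"
    and g_ne: "\<forall>x\<in>{a..b} - {\<zeta>}. g x \<noteq> 0 \<and> vdiff a b g x \<noteq> 0"
  shows "\<forall>N. (\<lambda>\<omega>. Hnu a b \<nu> f g \<omega> - partial_exp a b r \<nu> g \<zeta> f N \<omega>)
               \<in> O[at_top](\<lambda>\<omega>. of_real (\<omega> powr (- (real N + 1) - 1 / (real r + 1))))"
proof -
  have \<zeta>: "\<zeta> \<in> {a..b}" using zeta by auto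
  define gc where "gc x = complex_of_real (g x)" for x
  have gc: "smooth_cl a b gc" "\<And>n. vdiffs a b n gc \<zeta> = of_real (vdiffs a b n g \<zeta>)"
    unfolding gc_def[abs_def] using smooth_cl_of_real[OF ab g_smooth] \<zeta> by auto
  obtain G where G: "smooth_cl a b G"
    "\<And>x. x \<in> {a..b} \<Longrightarrow> gc x = (\<Sum>j<Suc r. ((x - \<zeta>) ^ j / fact j) *\<^sub>R vdiffs a b j gc \<zeta>) + (x - \<zeta>) ^ Suc r *\<^sub>R G x"
    "G \<zeta> = vdiffs a b (Suc r) gc \<zeta> /\<^sub>R fact (Suc r)"
    using smooth_cl_taylor[OF ab gc(1) \<zeta>, where n = "Suc r"] by blast
  \<comment> \<open>All Taylor coefficients up to index \<open>r\<close> vanish, so only the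
    remainder term of order \<open>r + 1\<close> survives.\<close>
  have g_eq: "of_real (g x) = of_real (x - \<zeta>) ^ Suc r * G x" if "x \<in> {a..b}" for x
    using G(2)[OF that] g_zero
    by (simp add: gc(2) gc_def less_Suc_eq_le scaleR_conv_of_real del: power_Suc of_real_diff)
  have G\<zeta>: "G \<zeta> \<noteq> 0" using G(3) g_nondeg by (simp add: gc(2) del: fact_Suc)
  have G_nz: "G x \<noteq> 0" if "x \<in> {a..b}" for x
    using g_eq[OF that] G\<zeta> g_ne that by (cases "x = \<zeta>") auto
  \<comment> \<open>The cofactor that the product rule produces from
    \<open>(x - \<zeta>) ^ (r + 1) * G x\<close>.\<close>
  define G1 where "G1 x = of_nat (Suc r) * G x + of_real (x - \<zeta>) * vdiff a b G x" for x
  have G1: "smooth_cl a b G1"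
    unfolding G1_def by (intro smooth_cl_add smooth_cl_mult smooth_cl_const smooth_cl_shift smooth_cl_vdiff G(1) ab)
  have dg: "(g has_real_derivative vdiff a b g x) (at x within {a..b})" if "x \<in> {a..b}" for x
    using smooth_cl_deriv[OF g_smooth that] by (simp add: has_real_derivative_iff_has_vector_derivative)
  have g'_eq: "of_real (vdiff a b g x) = of_real (x - \<zeta>) ^ r * G1 x" if x: "x \<in> {a..b}" for x
  proof -
    have d: "((\<lambda>x. x - \<zeta>) has_real_derivative 1) (at x within {a..b})"
      by (auto intro!: derivative_eq_intros)
    have "((\<lambda>x. (x - \<zeta>) ^ Suc r) has_real_derivative real (Suc r) * (x - \<zeta>) ^ r) (at x within {a..b})"
      using DERIV_power[OF d, of "Suc r"] by simp
    from has_vector_derivative_mult[OF has_vector_derivative_of_real[OF this] smooth_cl_deriv[OF G(1) x]]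
    have "((\<lambda>x. of_real ((x - \<zeta>) ^ Suc r) * G x) has_vector_derivative
        of_real (x - \<zeta>) ^ r * G1 x) (at x within {a..b})"
      by (rule has_vector_derivative_eq_rhs) (simp add: G1_def algebra_simps)
    then have "((\<lambda>x. complex_of_real (g x)) has_vector_derivative of_real (x - \<zeta>) ^ r * G1 x) (at x within {a..b})"
      by (rule has_vector_derivative_transform[OF x, rotated]) (simp only: g_eq of_real_power)
    from vdiff_eqI[OF ab x this] have "vdiff a b (\<lambda>x. complex_of_real (g x)) x = of_real (x - \<zeta>) ^ r * G1 x" .
    moreover have "vdiff a b (\<lambda>x. complex_of_real (g x)) x = of_real (vdiff a b g x)"
      by (rule vdiff_eqI[OF ab x has_vector_derivative_of_real[OF dg[OF x]]])
    ultimately show ?thesis by (simp only:)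
  qed
  \<comment> \<open>At \<zeta> the value is \<open>(r + 1) * G \<zeta>\<close>, nonzero by
    nondegeneracy; elsewhere the derivative of \<open>g\<close> is nonzero by hypothesis.\<close>
  have G1_nz: "G1 x \<noteq> 0" if "x \<in> {a..b}" for x
  proof (cases "x = \<zeta>")
    case True
    then show ?thesis using G\<zeta> by (simp add: G1_def del: of_nat_Suc)
  next
    case False
    then show ?thesis using g'_eq[OF that] g_ne that by auto
  qed
  interpret degenerate_phase a b \<zeta> r g G G1
    by unfold_locales (use zeta r dg g_eq g'_eq G(1) G1 G_nz G1_nz in auto)
  show ?thesis using partial_exp_bigo[OF f_smooth nu] by blast
qed

end
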